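(* Let $G$ be a deterministic $d$-regular graph on $n$ vertices, let $\lambda_2$ be the second largest eigenvalue of $\frac1dA_G$ and $\lambda_n$ its smallest eigenvalue, and assume $\lambda_2<1$. Let $\varepsilon\in(0,1/2)$ and $\delta>0$. If $$\frac{d}{\log n}\ \ge\ 4\frac{1+|\lambda_n|}{(1-\lambda_2)^2}(1+\delta)\left[\frac{1}{(1-2\varepsilon)^2}+\frac13\frac{1-\lambda_2}{(1-2\varepsilon)(1+|\lambda_n|)}+\frac13\frac{1-\lambda_2}{1+|\lambda_n|}-1\right],$$ then with probability at least $1-n^{-\delta}$ the semidefinite program $\max\operatorname{Tr}(WX)$ s.t. $X\succeq0$, $X_{ii}=1\ \forall i$, has $gg^T$ as its unique optimal solution, where $g_i=(-1)^{x_i}$. As $\varepsilon\to1/2$ the condition can be written $\frac{d}{\log n}\ge4\frac{1+|\lambda_n|}{(1-\lambda_2)^2}(1+\delta)\left[\frac{1}{(1-2\varepsilon)^2}+o\!\left(\frac{1}{(1-2\varepsilon)^2}\right)\right]$, and if moreover $\lambda_2=o(1)$ and $|\lambda_n|=o(1)$ it reads $\frac{d}{\log n}\ge\frac{4(1+\delta)}{(1-2\varepsilon)^2}+o\!\left(\frac{1}{(1-2\varepsilon)^2}\right)$.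
   Context: Model: $G=(V,E)$, $V=[n]$, with adjacency matrix $A_G$; unknown $x\in\{0,1\}^n$; for each edge $(i,j)$ one observes $Y_{(i,j)}=x_i\oplus x_j\oplus Z_{(i,j)}$ (mod 2) with $Z_{(i,j)}$ i.i.d. Bernoulli$(\varepsilon)$. $W\in\mathbb{R}^{n\times n}$ has $W(i,j)=(-1)^{Y_{(i,j)}}$ if $(i,j)\in E$ and $0$ otherwise. Equivalently $\lambda_2=\frac1d\max_{x\perp\mathbf 1}\frac{x^TA_Gx}{x^Tx}$ and $|\lambda_n|=\frac1d\max_{x\perp\mathbf 1}\left(-\frac{x^TA_Gx}{x^Tx}\right)$. Logarithms are natural. *)

theory Defs
  imports "HOL-Probability.Probability"
begin

text \<open>Vertices are 0,...,n-1. A simple graph is a symmetric irreflexive relation E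
  on {0..<n}. Vectors / matrices are functions nat => real (nat => nat => real)
  of which only the entries with indices < n matter.\<close>

definition simple_graph :: "nat \<Rightarrow> (nat \<Rightarrow> nat \<Rightarrow> bool) \<Rightarrow> bool" where
  "simple_graph n E \<longleftrightarrow> (\<forall>i j. E i j \<longrightarrow> i < n \<and> j < n) \<and>
     (\<forall>i j. E i j \<longrightarrow> E j i) \<and> (\<forall>i. \<not> E i i)"

definition regular :: "nat \<Rightarrow> (nat \<Rightarrow> nat \<Rightarrow> bool) \<Rightarrow> nat \<Rightarrow> bool" where
  "regular n E d \<longleftrightarrow> (\<forall>i<n. card {j. j < n \<and> E i j} = d)"

definition adj :: "(nat \<Rightarrow> nat \<Rightarrow> bool) \<Rightarrow> nat \<Rightarrow> nat \<Rightarrow> real" where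
  "adj E i j = (if E i j then 1 else 0)"

definition quad_form :: "nat \<Rightarrow> (nat \<Rightarrow> nat \<Rightarrow> real) \<Rightarrow> (nat \<Rightarrow> real) \<Rightarrow> real" where
  "quad_form n M x = (\<Sum>i<n. \<Sum>j<n. x i * M i j * x j)"

text \<open>(The max below is attained; Sup is used since the set of quotients is infinite.) Rayleigh quotients x^T A x / x^T x over nonzero x in R^n orthogonal to the all-ones vector.\<close>
definition rayleigh_perp :: "nat \<Rightarrow> (nat \<Rightarrow> nat \<Rightarrow> real) \<Rightarrow> real set" where
  "rayleigh_perp n M = {quad_form n M x / (\<Sum>i<n. (x i)\<^sup>2) | x.
       (\<Sum>i<n. x i) = 0 \<and> (\<exists>i<n. x i \<noteq> 0)}"

definition lambda2 :: "nat \<Rightarrow> (nat \<Rightarrow> nat \<Rightarrow> bool) \<Rightarrow> nat \<Rightarrow> real" where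
  "lambda2 n E d = (1 / real d) * Sup (rayleigh_perp n (adj E))"

definition abs_lambda_n :: "nat \<Rightarrow> (nat \<Rightarrow> nat \<Rightarrow> bool) \<Rightarrow> nat \<Rightarrow> real" where
  "abs_lambda_n n E d = (1 / real d) * Sup (uminus ` rayleigh_perp n (adj E))"

definition edge_set :: "(nat \<Rightarrow> nat \<Rightarrow> bool) \<Rightarrow> (nat \<times> nat) set" where
  "edge_set E = {(i, j). i < j \<and> E i j}"

definition noise_pmf :: "(nat \<Rightarrow> nat \<Rightarrow> bool) \<Rightarrow> real \<Rightarrow> (nat \<times> nat \<Rightarrow> bool) pmf" where
  "noise_pmf E eps = Pi_pmf (edge_set E) False (\<lambda>_. bernoulli_pmf eps)"

text \<open>Observation Y_(i,j) = x_i xor x_j xor Z_(i,j) (bits as bools, True = 1).\<close>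
definition obs :: "(nat \<Rightarrow> bool) \<Rightarrow> (nat \<times> nat \<Rightarrow> bool) \<Rightarrow> nat \<Rightarrow> nat \<Rightarrow> bool" where
  "obs x Z i j = ((x i \<noteq> x j) \<noteq> Z (min i j, max i j))"

definition Wmat :: "(nat \<Rightarrow> nat \<Rightarrow> bool) \<Rightarrow> (nat \<Rightarrow> bool) \<Rightarrow> (nat \<times> nat \<Rightarrow> bool) \<Rightarrow> nat \<Rightarrow> nat \<Rightarrow> real" where
  "Wmat E x Z i j = (if E i j then (if obs x Z i j then -1 else 1) else 0)"

definition psd :: "nat \<Rightarrow> (nat \<Rightarrow> nat \<Rightarrow> real) \<Rightarrow> bool" where
  "psd n X \<longleftrightarrow> (\<forall>i<n. \<forall>j<n. X i j = X j i) \<and> (\<forall>v. quad_form n X v \<ge> 0)"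

definition sdp_feasible :: "nat \<Rightarrow> (nat \<Rightarrow> nat \<Rightarrow> real) \<Rightarrow> bool" where
  "sdp_feasible n X \<longleftrightarrow> psd n X \<and> (\<forall>i<n. X i i = 1)"

definition tr_prod :: "nat \<Rightarrow> (nat \<Rightarrow> nat \<Rightarrow> real) \<Rightarrow> (nat \<Rightarrow> nat \<Rightarrow> real) \<Rightarrow> real" where
  "tr_prod n W X = (\<Sum>i<n. \<Sum>j<n. W i j * X j i)"

definition sdp_unique_opt :: "nat \<Rightarrow> (nat \<Rightarrow> nat \<Rightarrow> real) \<Rightarrow> (nat \<Rightarrow> nat \<Rightarrow> real) \<Rightarrow> bool" where
  "sdp_unique_opt n W X0 \<longleftrightarrow> sdp_feasible n X0 \<and>
     (\<forall>X. sdp_feasible n X \<longrightarrow> tr_prod n W X \<le> tr_prod n W X0) \<and>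
     (\<forall>X. sdp_feasible n X \<and> tr_prod n W X = tr_prod n W X0 \<longrightarrow>
          (\<forall>i<n. \<forall>j<n. X i j = X0 i j))"

end

theory Submission
  imports Defs
begin

text \<open>
  Conjugating by the signs \<open>g\<close> reduces to \<open>x = 0\<close>. Dual certification then asks that
  \<open>L\<^sub>G - 2 L\<^sub>H\<close> be positive definite on the complement of the constants, where \<open>H\<close> is the random
  subgraph of flipped edges. Since \<open>L\<^sub>G \<ge> d (1 - \<lambda>\<^sub>2)\<close> there, it suffices that the largest eigenvalue
  of \<open>L\<^sub>H - \<epsilon> L\<^sub>G = \<Sum>\<^sub>e (Z\<^sub>e - \<epsilon>) p\<^sub>e p\<^sub>e\<^sup>\<top>\<close>, with \<open>p\<^sub>e = e\<^sub>i - e\<^sub>j\<close>, stays below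
  \<open>(1 - 2\<epsilon>) d (1 - \<lambda>\<^sub>2) / 2\<close>.

  The matrix Bernstein bound for this sum is obtained without Lieb's theorem. For
  \<open>m(\<theta>) = E tr exp (\<theta> \<Sum>\<^sub>e (Z\<^sub>e - \<epsilon>) p\<^sub>e p\<^sub>e\<^sup>\<top>)\<close>, conditioning on all edges but \<open>e\<close> expresses \<open>m'\<close>
  through the two values of \<open>p\<^sub>e \<bullet> exp(\<dots>) p\<^sub>e\<close> at \<open>Z\<^sub>e = 0, 1\<close>. Adding the rank-one matrix \<open>u u\<^sup>\<top>\<close> to a
  positive semidefinite \<open>K\<close> increases \<open>u \<bullet> e\<^sup>K u\<close> by at most the factor \<open>exp (u \<bullet> u)\<close>, the commuting
  case being extremal. Together with \<open>\<Sum>\<^sub>e p\<^sub>e p\<^sub>e\<^sup>\<top> = L\<^sub>G \<le> d (1 + |\<lambda>\<^sub>n|)\<close> this yields a differential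
  inequality for \<open>m\<close> whose solution is a power of the scalar Bernoulli moment generating function,
  and the scalar Bernstein estimate finishes the proof.
\<close>

section \<open>Sums of rank-one operators\<close>

definition dot :: "nat \<Rightarrow> (nat \<Rightarrow> real) \<Rightarrow> (nat \<Rightarrow> real) \<Rightarrow> real" where
  "dot n u v = (\<Sum>i<n. u i * v i)"

definition unit_vec :: "nat \<Rightarrow> nat \<Rightarrow> real" where
  "unit_vec i = (\<lambda>j. of_bool (j = i))"

text \<open>The matrix \<open>\<Sum>\<^sub>l g\<^sub>l w\<^sub>l w\<^sub>l\<^sup>\<top>\<close>,
  kept together with its rank-one decomposition: nonnegative weights make positive semidefiniteness
  visible, and an odd power can be opened at its middle factor in place of taking a square
  root.\<close>

definition frame_op ::
  "nat \<Rightarrow> 'i set \<Rightarrow> ('i \<Rightarrow> real) \<Rightarrow> ('i \<Rightarrow> nat \<Rightarrow> real) \<Rightarrow> (nat \<Rightarrow> real) \<Rightarrow> nat \<Rightarrow> real" where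
  "frame_op n I g w v = (\<lambda>i. \<Sum>l\<in>I. g l * dot n (w l) v * w l i)"

lemma dot_commute: "dot n u v = dot n v u"
  by (simp add: dot_def mult.commute)

lemma dot_self_nonneg: "0 \<le> dot n u u"
  by (simp add: dot_def sum_nonneg)

lemma dot_sum_right: "dot n u (\<lambda>i. \<Sum>l\<in>I. c l * f l i) = (\<Sum>l\<in>I. c l * dot n u (f l))"
  unfolding dot_def sum_distrib_left
  by (subst sum.swap) (simp add: mult_ac)

lemma dot_add_right: "dot n u (\<lambda>i. f i + h i) = dot n u f + dot n u h"
  by (simp add: dot_def sum.distrib distrib_left)

lemma dot_scale_right: "dot n u (\<lambda>i. c * f i) = c * dot n u f"
  by (simp add: dot_def sum_distrib_left mult_ac)

lemma dot_unit_right: "i < n \<Longrightarrow> dot n u (unit_vec i) = u i"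
  by (simp add: dot_def unit_vec_def)

lemma sum_dot_unit: "(\<Sum>i<n. dot n u (unit_vec i) * dot n v (unit_vec i)) = dot n u v"
  unfolding dot_def[of n u v] by (intro sum.cong) (auto simp: dot_unit_right)

lemma weighted_Cauchy_Schwarz:
  fixes a b g :: "'i \<Rightarrow> real"
  assumes "\<And>l. l \<in> I \<Longrightarrow> 0 \<le> g l"
  shows "(\<Sum>l\<in>I. g l * a l * b l)\<^sup>2 \<le> (\<Sum>l\<in>I. g l * (a l)\<^sup>2) * (\<Sum>l\<in>I. g l * (b l)\<^sup>2)"
proof -
  have "(\<Sum>l\<in>I. g l * a l * b l) = (\<Sum>l\<in>I. (sqrt (g l) * a l) * (sqrt (g l) * b l))"
    using assms by (intro sum.cong refl) (simp add: mult_ac flip: power2_eq_square)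
  moreover have "(\<Sum>l\<in>I. g l * (a l)\<^sup>2) = (\<Sum>l\<in>I. (sqrt (g l) * a l)\<^sup>2)" for a
    using assms by (intro sum.cong refl) (simp add: power_mult_distrib)
  ultimately show ?thesis
    by (simp add: Cauchy_Schwarz_ineq_sum)
qed

lemma dot_Cauchy_Schwarz: "(dot n u v)\<^sup>2 \<le> dot n u u * dot n v v"
  using Cauchy_Schwarz_ineq_sum[of u v "{..<n}"] by (simp add: dot_def power2_eq_square)

text \<open>Ratios of consecutive terms increase, so moving one unit of index from the smaller to
  the larger factor can only increase the product; repeating this brings the smaller index down to
  0.\<close>

lemma log_convex_seq_mult_le:
  fixes k :: "nat \<Rightarrow> real"
  assumes nonneg: "\<And>a. 0 \<le> k a"
    and lc: "\<And>a. (k (Suc a))\<^sup>2 \<le> k a * k (Suc (Suc a))"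
  shows "k a * k b \<le> k 0 * k (a + b)"
proof -
  have step: "k (Suc a) * k (a + m) \<le> k a * k (Suc (a + m))" for a m
  proof (induction m)
    case 0
    then show ?case by simp
  next
    case (Suc m)
    show ?case
    \<comment> \<open>A zero term has no ratio, but log-convexity then forces the next term to
      vanish, and with it the left-hand side.\<close>
    proof (cases "k (a + m) = 0")
      case True
      then have "k (Suc (a + m)) = 0"
        using lc[of "a + m"] by simp
      then show ?thesis using nonneg by simp
    next
      case False
      then have pos: "0 < k (a + m)"
        using nonneg[of "a + m"] by simp
      have "k (a + m) * (k (Suc a) * k (Suc (a + m))) \<le> k a * (k (Suc (a + m)))\<^sup>2"
        using mult_right_mono[OF Suc nonneg[of "Suc (a + m)"]]
        by (simp add: power2_eq_square mult_ac)
      also have "\<dots> \<le> k a * (k (a + m) * k (Suc (Suc (a + m))))"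
        by (intro mult_left_mono lc nonneg)
      finally have "k (a + m) * (k (Suc a) * k (Suc (a + m))) \<le> k (a + m) * (k a * k (Suc (Suc (a + m))))"
        by (simp add: mult_ac)
      with pos show ?thesis by simp
    qed
  qed
  have le: "k a * k b \<le> k 0 * k (a + b)" if "a \<le> b" for a b
    using that
  proof (induction a arbitrary: b)
    case 0
    then show ?case by simp
  next
    case (Suc a)
    have "k (Suc a) * k b \<le> k a * k (Suc b)"
      using step[of a "b - a"] Suc.prems by simp
    also have "\<dots> \<le> k 0 * k (a + Suc b)"
      using Suc.prems by (intro Suc.IH) simp
    finally show ?case by simp
  qed
  show ?thesis
    using le[of a b] le[of b a] by (cases "a \<le> b") (simp_all add: mult.commute add.commute)
qed

section \<open>Moments of a positive semidefinite operator\<close>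

locale frame =
  fixes n :: nat and I :: "'i set" and g :: "'i \<Rightarrow> real" and w :: "'i \<Rightarrow> nat \<Rightarrow> real"
  assumes weight_nonneg: "l \<in> I \<Longrightarrow> 0 \<le> g l"
begin

abbreviation T :: "(nat \<Rightarrow> real) \<Rightarrow> nat \<Rightarrow> real" where
  "T \<equiv> frame_op n I g w"

text \<open>These are the moments of the spectral measure of \<open>T\<close> at
  \<open>u\<close>.\<close>

definition moment :: "(nat \<Rightarrow> real) \<Rightarrow> nat \<Rightarrow> real" where
  "moment u a = dot n u ((T ^^ a) u)"

lemma dot_T: "dot n u (T v) = (\<Sum>l\<in>I. g l * dot n (w l) u * dot n (w l) v)"
  unfolding frame_op_def dot_sum_right by (simp add: mult_ac dot_commute)

lemma dot_T_commute: "dot n u (T v) = dot n (T u) v"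
  by (subst (2) dot_commute) (simp add: dot_T mult_ac)

lemma dot_T_pow_commute: "dot n u ((T ^^ a) v) = dot n ((T ^^ a) u) v"
proof (induction a arbitrary: u v)
  case (Suc a)
  have "dot n u ((T ^^ Suc a) v) = dot n (T u) ((T ^^ a) v)"
    by (simp add: dot_T_commute)
  also have "\<dots> = dot n ((T ^^ a) (T u)) v" by (rule Suc)
  finally show ?case by (simp add: funpow_swap1)
qed simp

lemma dot_T_pow_add: "dot n u ((T ^^ (a + b)) v) = dot n ((T ^^ a) u) ((T ^^ b) v)"
  by (simp add: funpow_add dot_T_pow_commute)

lemma dot_T_self: "dot n x (T x) = (\<Sum>l\<in>I. g l * (dot n (w l) x)\<^sup>2)"
  by (simp add: dot_T power2_eq_square mult_ac)

lemma moment_even: "moment u (2 * l) = dot n ((T ^^ l) u) ((T ^^ l) u)"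
  unfolding moment_def mult_2 dot_T_pow_add ..

lemma moment_odd: "moment u (Suc (2 * l)) = dot n ((T ^^ l) u) (T ((T ^^ l) u))"
  using dot_T_pow_add[of u l "Suc l" u] by (simp add: moment_def mult_2)

lemma moment_nonneg: "0 \<le> moment u a"
proof (cases "even a")
  case True
  then show ?thesis by (auto elim!: evenE simp: moment_even dot_self_nonneg)
next
  case False
  then show ?thesis
    by (auto elim!: oddE simp: moment_odd dot_T_self weight_nonneg intro!: sum_nonneg)
qed

text \<open>Cauchy-Schwarz applied to \<open>x = (T ^^ l) u\<close> and \<open>T x\<close>: for even
  \<open>a\<close> with the inner product, for odd \<open>a\<close> with the semidefinite form of
  \<open>T\<close> itself.\<close>

lemma moment_log_convex: "(moment u (Suc a))\<^sup>2 \<le> moment u a * moment u (Suc (Suc a))"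
proof (cases "even a")
  case True
  then obtain l where a: "a = 2 * l" by (elim evenE)
  have "moment u (Suc (Suc a)) = dot n (T ((T ^^ l) u)) (T ((T ^^ l) u))"
    using moment_even[of u "Suc l"] by (simp add: a)
  then show ?thesis
    by (simp add: a moment_even moment_odd dot_Cauchy_Schwarz)
next
  case False
  then obtain l where a: "a = Suc (2 * l)" by (auto elim!: oddE)
  define x where "x = (T ^^ l) u"
  have "moment u (Suc a) = dot n x (T (T x))"
    using moment_even[of u "Suc l"] by (simp add: a x_def dot_T_commute)
  moreover have "moment u (Suc (Suc a)) = dot n (T x) (T (T x))"
    using moment_odd[of u "Suc l"] by (simp add: a x_def)
  moreover have "moment u a = dot n x (T x)"
    by (simp add: a x_def moment_odd)
  ultimately show ?thesis
    using weighted_Cauchy_Schwarz[OF weight_nonneg, where I = I, of "\<lambda>l. l" "\<lambda>l. dot n (w l) x" "\<lambda>l. dot n (w l) (T x)"]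
    by (simp add: dot_T_self) (simp add: dot_T)
qed

lemma moment_0: "moment u 0 = dot n u u"
  by (simp add: moment_def)

text \<open>Equality holds when \<open>u\<close> is an eigenvector of \<open>T\<close>; this is the
  sense in which the commuting case is extremal.\<close>

lemma moment_mult_le: "moment u a * moment u b \<le> dot n u u * moment u (a + b)"
  using log_convex_seq_mult_le[of "moment u", OF moment_nonneg moment_log_convex]
  by (simp add: moment_0)

text \<open>Geometric growth makes the exponential series converge for every argument.\<close>

lemma moment_growth:
  obtains B where "0 \<le> B" "\<And>u a. moment u a \<le> dot n u u * B ^ a"
proof
  \<comment> \<open>The trace of \<open>T\<close>, which dominates its quadratic form by
    Cauchy-Schwarz in each rank-one term.\<close>
  define B where "B = (\<Sum>l\<in>I. g l * dot n (w l) (w l))"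
  show B: "0 \<le> B"
    unfolding B_def by (intro sum_nonneg mult_nonneg_nonneg weight_nonneg dot_self_nonneg)
  have form: "dot n x (T x) \<le> B * dot n x x" for x
    unfolding dot_T_self B_def sum_distrib_right
    by (intro sum_mono) (simp add: mult.assoc mult_left_mono[OF dot_Cauchy_Schwarz] weight_nonneg)
  have even: "moment u (Suc (2 * l)) \<le> B * moment u (2 * l)" for u l
    by (simp add: moment_even moment_odd form)
  have step: "moment u (Suc a) \<le> B * moment u a" for u a
  proof (cases "even a \<or> moment u (Suc a) = 0")
    case True
    then show ?thesis using even B moment_nonneg[of u a] by (auto elim!: evenE)
  next
    \<comment> \<open>For odd \<open>a\<close> the form bound is not directly available:
      log-convexity at \<open>a\<close>, combined with the bound from \<open>Suc a\<close> to the
      next index, leaves one factor \<open>moment u (Suc a)\<close> to cancel.\<close>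
    case False
    then obtain l where a: "Suc a = 2 * l" by (metis even_Suc evenE)
    have "moment u (Suc a) * moment u (Suc a) \<le> moment u a * moment u (Suc (Suc a))"
      using moment_log_convex[of u a] by (simp add: power2_eq_square)
    also have "\<dots> \<le> moment u a * (B * moment u (Suc a))"
      unfolding a by (intro mult_left_mono even moment_nonneg)
    finally have "moment u (Suc a) * moment u (Suc a) \<le> (B * moment u a) * moment u (Suc a)"
      by (simp add: mult_ac)
    then show ?thesis
      using False moment_nonneg[of u "Suc a"] by simp
  qed
  show "moment u a \<le> dot n u u * B ^ a" for u a
  proof (induction a)
    case 0
    then show ?case by (simp add: moment_0)
  next
    case (Suc a)
    have "moment u (Suc a) \<le> B * (dot n u u * B ^ a)"
      using step[of u a] mult_left_mono[OF Suc B] by linarith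
    then show ?case by (simp add: mult_ac)
  qed
qed

section \<open>Exponential series and trace comparison\<close>

text \<open>The value \<open>u \<bullet> e\<^sup>\<theta>\<^sup>T u\<close>.\<close>

definition exp_form :: "(nat \<Rightarrow> real) \<Rightarrow> real \<Rightarrow> real" where
  "exp_form u \<theta> = (\<Sum>k. moment u k / fact k * \<theta> ^ k)"

lemma summable_exp_form: "summable (\<lambda>k. moment u k / fact k * \<theta> ^ k)"
proof -
  obtain B where B: "0 \<le> B" "\<And>u a. moment u a \<le> dot n u u * B ^ a"
    using moment_growth by blast
  have "summable (\<lambda>k. dot n u u * (inverse (fact k) * (B * \<bar>\<theta>\<bar>) ^ k))"
    by (intro summable_mult summable_exp)
  then show ?thesis
  proof (rule summable_comparison_test[rotated], intro exI allI impI)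
    fix k :: nat
    have "moment u k * \<bar>\<theta>\<bar> ^ k / fact k \<le> dot n u u * B ^ k * \<bar>\<theta>\<bar> ^ k / fact k"
      by (intro divide_right_mono mult_right_mono B) auto
    then show "norm (moment u k / fact k * \<theta> ^ k) \<le> dot n u u * (inverse (fact k) * (B * \<bar>\<theta>\<bar>) ^ k)"
      using moment_nonneg[of u k]
      by (simp add: abs_mult power_abs power_mult_distrib divide_simps mult_ac)
  qed
qed

lemma exp_form_nonneg: "0 \<le> \<theta> \<Longrightarrow> 0 \<le> exp_form u \<theta>"
  unfolding exp_form_def by (intro suminf_nonneg summable_exp_form) (simp add: moment_nonneg)

lemma exp_form_sums: "(\<lambda>k. moment u k / fact k * \<theta> ^ k) sums exp_form u \<theta>"
  unfolding exp_form_def by (intro summable_sums summable_exp_form)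

lemma sum_scaled_moments:
  "(\<Sum>e\<in>S. moment (p e) k / fact k * \<theta> ^ k) = (\<Sum>e\<in>S. moment (p e) k) * (\<theta> ^ k / fact k)"
  unfolding sum_distrib_right by (intro sum.cong refl) simp

text \<open>With \<open>P = \<Sum>\<^sub>e p\<^sub>e p\<^sub>e\<^sup>\<top>\<close> the left side is
  the trace of \<open>T\<^sup>k P\<close>, and \<open>P\<close> is at most
  \<open>\<kappa> I\<close>. For \<open>k = 2 * l\<close> the bound is used on the vectors
  \<open>(T ^^ l) (unit_vec i)\<close>; for odd \<open>k\<close> the middle factor \<open>T\<close>
  is opened and it is used on \<open>(T ^^ l) (w j)\<close>.\<close>

lemma sum_moment_le_trace:
  assumes frame_bound: "\<And>x. (\<Sum>e\<in>S. (dot n (p e) x)\<^sup>2) \<le> \<kappa> * dot n x x"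
  shows "(\<Sum>e\<in>S. moment (p e) k) \<le> \<kappa> * (\<Sum>i<n. moment (unit_vec i) k)"
proof -
  have parseval: "dot n ((T ^^ l) x) ((T ^^ l) x) = (\<Sum>i<n. (dot n ((T ^^ l) (unit_vec i)) x)\<^sup>2)" for l x
  proof -
    have "dot n ((T ^^ l) x) ((T ^^ l) x) = (\<Sum>i<n. (dot n ((T ^^ l) x) (unit_vec i))\<^sup>2)"
      by (simp add: power2_eq_square sum_dot_unit)
    moreover have "dot n ((T ^^ l) x) (unit_vec i) = dot n ((T ^^ l) (unit_vec i)) x" for i
      by (metis dot_T_pow_commute dot_commute)
    ultimately show ?thesis by simp
  qed
  show ?thesis
  proof (cases "even k")
    case True
    then obtain l where k: "k = 2 * l" by (elim evenE)
    have "(\<Sum>e\<in>S. moment (p e) k) = (\<Sum>i<n. \<Sum>e\<in>S. (dot n (p e) ((T ^^ l) (unit_vec i)))\<^sup>2)"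
      unfolding k moment_even parseval by (subst sum.swap) (simp add: dot_commute)
    also have "\<dots> \<le> (\<Sum>i<n. \<kappa> * moment (unit_vec i) k)"
      unfolding k moment_even by (intro sum_mono frame_bound)
    finally show ?thesis by (simp add: sum_distrib_left)
  next
    case False
    then obtain l where k: "k = Suc (2 * l)" by (auto elim!: oddE)
    have odd: "moment x k = (\<Sum>j\<in>I. g j * (dot n x ((T ^^ l) (w j)))\<^sup>2)" for x
    proof -
      have "dot n (w j) ((T ^^ l) x) = dot n x ((T ^^ l) (w j))" for j
        by (metis dot_T_pow_commute dot_commute)
      then show ?thesis
        unfolding k moment_odd dot_T_self by simp
    qed
    have "(\<Sum>e\<in>S. moment (p e) k) = (\<Sum>j\<in>I. g j * (\<Sum>e\<in>S. (dot n (p e) ((T ^^ l) (w j)))\<^sup>2))"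
      unfolding odd sum_distrib_left by (rule sum.swap)
    also have "\<dots> \<le> (\<Sum>j\<in>I. g j * (\<kappa> * dot n ((T ^^ l) (w j)) ((T ^^ l) (w j))))"
      by (intro sum_mono mult_left_mono frame_bound weight_nonneg)
    also have "\<dots> = \<kappa> * (\<Sum>j\<in>I. g j * (\<Sum>i<n. (dot n (unit_vec i) ((T ^^ l) (w j)))\<^sup>2))"
      unfolding sum_distrib_left[of \<kappa>]
      by (simp add: power2_eq_square dot_commute[of n "unit_vec _"] sum_dot_unit mult_ac)
    also have "\<dots> = \<kappa> * (\<Sum>i<n. moment (unit_vec i) k)"
      unfolding odd sum_distrib_left[of "g _"] by (subst sum.swap) simp
    finally show ?thesis .
  qed
qed

lemma sum_exp_form_le_trace:
  assumes frame_bound: "\<And>x. (\<Sum>e\<in>S. (dot n (p e) x)\<^sup>2) \<le> \<kappa> * dot n x x"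
    and "0 \<le> \<theta>"
  shows "(\<Sum>e\<in>S. exp_form (p e) \<theta>) \<le> \<kappa> * (\<Sum>i<n. exp_form (unit_vec i) \<theta>)"
proof -
  have "(\<lambda>k. \<Sum>e\<in>S. moment (p e) k / fact k * \<theta> ^ k) sums (\<Sum>e\<in>S. exp_form (p e) \<theta>)"
    by (intro sums_sum exp_form_sums)
  moreover have "(\<lambda>k. \<kappa> * (\<Sum>i<n. moment (unit_vec i) k / fact k * \<theta> ^ k)) sums (\<kappa> * (\<Sum>i<n. exp_form (unit_vec i) \<theta>))"
    by (intro sums_mult sums_sum exp_form_sums)
  moreover have "(\<Sum>e\<in>S. moment (p e) k / fact k * \<theta> ^ k) \<le> \<kappa> * (\<Sum>i<n. moment (unit_vec i) k / fact k * \<theta> ^ k)" for k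
  proof -
    have "(\<Sum>e\<in>S. moment (p e) k) * (\<theta> ^ k / fact k) \<le> \<kappa> * (\<Sum>i<n. moment (unit_vec i) k) * (\<theta> ^ k / fact k)"
      using \<open>0 \<le> \<theta>\<close> by (intro mult_right_mono sum_moment_le_trace frame_bound) auto
    then show ?thesis
      unfolding sum_scaled_moments by (simp only: mult.assoc)
  qed
  ultimately show ?thesis
    by (rule sums_le[rotated])
qed

text \<open>Cyclicity of the trace after opening one factor \<open>T\<close>. It feeds the
  derivative of the trace exponential.\<close>

lemma trace_pow_Suc:
  "(\<Sum>i<n. moment (unit_vec i) (Suc k)) = (\<Sum>l\<in>I. g l * moment (w l) k)"
proof -
  have "moment (unit_vec i) (Suc k) = (\<Sum>l\<in>I. g l * (dot n ((T ^^ k) (w l)) (unit_vec i) * dot n (w l) (unit_vec i)))" for i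
  proof -
    have "moment (unit_vec i) (Suc k) = dot n ((T ^^ k) (unit_vec i)) (T (unit_vec i))"
      using dot_T_pow_add[of "unit_vec i" k 1 "unit_vec i"] by (simp add: moment_def)
    then show ?thesis
      by (simp add: dot_T dot_T_pow_commute mult_ac)
  qed
  then have "(\<Sum>i<n. moment (unit_vec i) (Suc k))
      = (\<Sum>l\<in>I. g l * (\<Sum>i<n. dot n ((T ^^ k) (w l)) (unit_vec i) * dot n (w l) (unit_vec i)))"
    by (simp add: sum_distrib_left) (rule sum.swap)
  then show ?thesis
    unfolding sum_dot_unit by (simp add: moment_def dot_commute)
qed

text \<open>Any vector with Rayleigh quotient at least \<open>\<tau>\<close> serves in place of a
  top eigenvector: \<open>moment_mult_le\<close> gives the Jensen-type bound on each power, and the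
  exponential series are compared termwise.\<close>

lemma exp_le_trace:
  assumes x: "0 < dot n x x" and lower: "\<tau> * dot n x x \<le> dot n x (T x)" and "0 \<le> \<tau>" "0 \<le> \<theta>"
  shows "exp (\<theta> * \<tau>) \<le> (\<Sum>i<n. exp_form (unit_vec i) \<theta>)"
proof -
  have pow: "\<tau> ^ k * dot n x x \<le> moment x k" for k
  proof (induction k)
    case 0
    then show ?case by (simp add: moment_0)
  next
    case (Suc k)
    have "\<tau> * dot n x x * moment x k \<le> moment x 1 * moment x k"
      using lower by (intro mult_right_mono moment_nonneg) (simp add: moment_def)
    also have "\<dots> \<le> dot n x x * moment x (Suc k)"
      using moment_mult_le[of x 1 k] by simp
    finally have "\<tau> * moment x k \<le> moment x (Suc k)"
      using x by (simp add: mult_ac)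
    with mult_left_mono[OF Suc \<open>0 \<le> \<tau>\<close>] show ?case
      by (simp add: mult_ac)
  qed
  \<comment> \<open>The one-element family consisting of \<open>x\<close> satisfies the frame bound
    with constant \<open>dot n x x\<close>, by Cauchy-Schwarz.\<close>
  have "dot n x x * \<tau> ^ k \<le> dot n x x * (\<Sum>i<n. moment (unit_vec i) k)" for k
    using pow[of k] sum_moment_le_trace[of "\<lambda>_. x" "{()}" "dot n x x" k] dot_Cauchy_Schwarz[of n x]
    by (simp add: mult.commute)
  with x have tr: "\<tau> ^ k \<le> (\<Sum>i<n. moment (unit_vec i) k)" for k
    by simp
  have "(\<lambda>k. (\<theta> * \<tau>) ^ k /\<^sub>R fact k) sums exp (\<theta> * \<tau>)"
    by (rule exp_converges)
  moreover have "(\<lambda>k. \<Sum>i<n. moment (unit_vec i) k / fact k * \<theta> ^ k) sums (\<Sum>i<n. exp_form (unit_vec i) \<theta>)"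
    by (intro sums_sum exp_form_sums)
  moreover have "(\<theta> * \<tau>) ^ k /\<^sub>R fact k \<le> (\<Sum>i<n. moment (unit_vec i) k / fact k * \<theta> ^ k)" for k
  proof -
    have "\<tau> ^ k * (\<theta> ^ k / fact k) \<le> (\<Sum>i<n. moment (unit_vec i) k) * (\<theta> ^ k / fact k)"
      using \<open>0 \<le> \<theta>\<close> by (intro mult_right_mono tr) auto
    then show ?thesis
      unfolding sum_scaled_moments by (simp only: power_mult_distrib real_scaleR_def divide_inverse mult_ac)
  qed
  ultimately show ?thesis by (rule sums_le[rotated])
qed

section \<open>Exponentials under a rank-one update\<close>

text \<open>\<open>binomial_moment u a m\<close> is \<open>u \<bullet> T\<^sup>a (T + (u \<bullet> u) I)\<^sup>m u\<close>.\<close>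

definition binomial_moment :: "(nat \<Rightarrow> real) \<Rightarrow> nat \<Rightarrow> nat \<Rightarrow> real" where
  "binomial_moment u a m = (\<Sum>j\<le>m. real (m choose j) * dot n u u ^ (m - j) * moment u (a + j))"

lemma binomial_moment_Suc:
  "binomial_moment u a (Suc m) = binomial_moment u (Suc a) m + dot n u u * binomial_moment u a m"
proof -
  let ?N = "dot n u u" and ?k = "moment u"
  have "?N * binomial_moment u a m = (\<Sum>j\<le>m. real (m choose j) * ?N ^ (Suc m - j) * ?k (a + j))"
    unfolding binomial_moment_def sum_distrib_left
    by (intro sum.cong) (auto simp: Suc_diff_le)
  also have "\<dots> = (\<Sum>j\<le>Suc m. real (m choose j) * ?N ^ (Suc m - j) * ?k (a + j))"
    by simp
  also have "\<dots> = ?N ^ Suc m * ?k a + (\<Sum>j\<le>m. real (m choose Suc j) * ?N ^ (m - j) * ?k (a + Suc j))"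
    by (subst sum.atMost_Suc_shift) simp
  finally have "binomial_moment u (Suc a) m + ?N * binomial_moment u a m
      = ?N ^ Suc m * ?k a + (\<Sum>j\<le>m. real (Suc m choose Suc j) * ?N ^ (m - j) * ?k (a + Suc j))"
    by (simp add: binomial_moment_def distrib_right flip: sum.distrib)
  also have "\<dots> = binomial_moment u a (Suc m)"
    unfolding binomial_moment_def by (subst sum.atMost_Suc_shift) simp
  finally show ?thesis ..
qed

text \<open>A word split at a factor \<open>u u\<^sup>\<top>\<close> is at most the unsplit word
  with the scalar \<open>dot n u u\<close> in that place; \<open>moment_mult_le\<close> gives this
  term by term.\<close>

lemma moment_mult_binomial_moment_le:
  "moment u a * binomial_moment u 0 m \<le> dot n u u * binomial_moment u a m"
  unfolding binomial_moment_def sum_distrib_left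
proof (rule sum_mono)
  fix j
  have "(real (m choose j) * dot n u u ^ (m - j)) * (moment u a * moment u j)
      \<le> (real (m choose j) * dot n u u ^ (m - j)) * (dot n u u * moment u (a + j))"
    by (intro mult_left_mono moment_mult_le) (simp add: dot_self_nonneg)
  then show "moment u a * (real (m choose j) * dot n u u ^ (m - j) * moment u (0 + j))
      \<le> dot n u u * (real (m choose j) * dot n u u ^ (m - j) * moment u (a + j))"
    by (simp add: mult_ac)
qed

text \<open>\<open>T\<close> commutes with the identity, so the exponential of
  \<open>\<theta> (T + (u \<bullet> u) I)\<close> factors; on the level of series this is a Cauchy
  product.\<close>

lemma binomial_moment_sums:
  assumes "0 \<le> \<theta>"
  shows "(\<lambda>m. binomial_moment u 0 m / fact m * \<theta> ^ m) sums (exp (dot n u u * \<theta>) * exp_form u \<theta>)"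
proof -
  let ?N = "dot n u u"
  have "(\<lambda>m. \<Sum>j\<le>m. (moment u j / fact j * \<theta> ^ j) * ((?N * \<theta>) ^ (m - j) /\<^sub>R fact (m - j)))
      sums ((\<Sum>m. moment u m / fact m * \<theta> ^ m) * (\<Sum>m. (?N * \<theta>) ^ m /\<^sub>R fact m))"
  proof (rule Cauchy_product_sums)
    show "summable (\<lambda>k. norm (moment u k / fact k * \<theta> ^ k))"
      using summable_exp_form[of u \<theta>] assms by (simp add: abs_mult moment_nonneg)
    show "summable (\<lambda>k. norm ((?N * \<theta>) ^ k /\<^sub>R fact k))"
      by (rule summable_norm_exp)
  qed
  moreover have "(\<Sum>j\<le>m. (moment u j / fact j * \<theta> ^ j) * ((?N * \<theta>) ^ (m - j) /\<^sub>R fact (m - j)))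
      = binomial_moment u 0 m / fact m * \<theta> ^ m" for m
    unfolding binomial_moment_def sum_divide_distrib sum_distrib_right
  proof (intro sum.cong refl)
    fix j assume "j \<in> {..m}"
    then have j: "j \<le> m" by simp
    then have "\<theta> ^ m = \<theta> ^ j * \<theta> ^ (m - j)"
      by (simp flip: power_add)
    with j show "(moment u j / fact j * \<theta> ^ j) * ((?N * \<theta>) ^ (m - j) /\<^sub>R fact (m - j))
        = real (m choose j) * ?N ^ (m - j) * moment u (0 + j) / fact m * \<theta> ^ m"
      by (simp add: binomial_fact power_mult_distrib divide_inverse mult_ac)
  qed
  ultimately show ?thesis
    by (simp add: exp_form_def exp_def mult.commute)
qed

text \<open>Every word in \<open>T\<close> and \<open>u u\<^sup>\<top>\<close> evaluates to a product of moments, which log-convexity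
  bounds by a single moment, as if \<open>u\<close> were an eigenvector.\<close>

lemma exp_form_rank_one_update:
  assumes fr: "frame I g'" and "0 \<le> \<theta>"
    and upd: "\<And>v. frame_op n I g' w v = (\<lambda>i. T v i + dot n u v * u i)"
  shows "frame.exp_form n I g' w u \<theta> \<le> exp (dot n u u * \<theta>) * exp_form u \<theta>"
proof -
  interpret upd: frame n I g' w by (rule fr)
  \<comment> \<open>The prefix exponent \<open>a\<close> stays general because expanding the
    outermost updated factor either moves a \<open>T\<close> to the left, raising \<open>a\<close>,
    or splits the word at \<open>u u\<^sup>\<top>\<close>.\<close>
  have le: "dot n ((T ^^ a) u) ((upd.T ^^ m) u) \<le> binomial_moment u a m" for a m
  proof (induction m arbitrary: a)
    case 0
    then show ?case by (simp add: binomial_moment_def moment_def dot_commute)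
  next
    case (Suc m)
    have "dot n ((T ^^ a) u) ((upd.T ^^ Suc m) u)
        = dot n ((T ^^ a) u) (T ((upd.T ^^ m) u)) + dot n u ((upd.T ^^ m) u) * dot n ((T ^^ a) u) u"
      by (simp add: upd dot_add_right dot_scale_right)
    also have "\<dots> = dot n ((T ^^ Suc a) u) ((upd.T ^^ m) u) + moment u a * dot n ((T ^^ 0) u) ((upd.T ^^ m) u)"
      by (simp add: dot_T_commute moment_def dot_commute[of n "(T ^^ a) u" u] mult.commute)
    also have "\<dots> \<le> binomial_moment u (Suc a) m + moment u a * binomial_moment u 0 m"
      by (intro add_mono mult_left_mono Suc moment_nonneg)
    also have "\<dots> \<le> binomial_moment u a (Suc m)"
      using moment_mult_binomial_moment_le[of u a m] by (simp add: binomial_moment_Suc)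
    finally show ?case .
  qed
  have "upd.moment u m / fact m * \<theta> ^ m \<le> binomial_moment u 0 m / fact m * \<theta> ^ m" for m
    using le[of 0 m] \<open>0 \<le> \<theta>\<close>
    by (intro mult_right_mono divide_right_mono) (simp_all add: upd.moment_def)
  then show ?thesis
    by (intro sums_le[OF _ upd.exp_form_sums binomial_moment_sums] \<open>0 \<le> \<theta>\<close>)
qed

end

section \<open>Bernstein inequality for random sums of rank-one operators\<close>

lemma finite_set_Pi_bernoulli:
  "finite S \<Longrightarrow> finite (set_pmf (Pi_pmf S False (\<lambda>_. bernoulli_pmf eps)))"
  by (rule finite_subset[OF set_Pi_pmf_subset' finite_PiE_dflt]) simp_all

lemma expectation_Pi_bernoulli_split:
  fixes \<Phi> :: "('e \<Rightarrow> bool) \<Rightarrow> real"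
  assumes "finite S" "e \<in> S" "0 \<le> eps" "eps \<le> 1"
  shows "measure_pmf.expectation (Pi_pmf S False (\<lambda>_. bernoulli_pmf eps)) \<Phi>
    = measure_pmf.expectation (Pi_pmf (S - {e}) False (\<lambda>_. bernoulli_pmf eps))
        (\<lambda>Z. eps * \<Phi> (Z(e := True)) + (1 - eps) * \<Phi> (Z(e := False)))"
proof -
  let ?R = "Pi_pmf (S - {e}) False (\<lambda>_. bernoulli_pmf eps)"
  have fin: "finite (set_pmf ?R)"
    using assms by (simp add: finite_set_Pi_bernoulli)
  have int: "integrable (measure_pmf ?R) h" for h :: "_ \<Rightarrow> real"
    using fin by (rule integrable_measure_pmf_finite)
  have "Pi_pmf S False (\<lambda>_. bernoulli_pmf eps)
      = bernoulli_pmf eps \<bind> (\<lambda>y. map_pmf (\<lambda>Z. Z(e := y)) ?R)"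
    using Pi_pmf_insert'[of "S - {e}" e False "\<lambda>_. bernoulli_pmf eps"] assms(1)
    unfolding map_pmf_def insert_Diff[OF \<open>e \<in> S\<close>] by blast
  then have "measure_pmf.expectation (Pi_pmf S False (\<lambda>_. bernoulli_pmf eps)) \<Phi>
      = measure_pmf.expectation (bernoulli_pmf eps \<bind> (\<lambda>y. map_pmf (\<lambda>Z. Z(e := y)) ?R)) \<Phi>"
    by simp
  also have "\<dots> = (\<Sum>y\<in>UNIV. pmf (bernoulli_pmf eps) y
      *\<^sub>R measure_pmf.expectation (map_pmf (\<lambda>Z. Z(e := y)) ?R) \<Phi>)"
    using fin by (intro pmf_expectation_bind) (simp_all only: set_map_pmf finite_imageI subset_UNIV finite)
  also have "\<dots> = eps * measure_pmf.expectation ?R (\<lambda>Z. \<Phi> (Z(e := True)))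
        + (1 - eps) * measure_pmf.expectation ?R (\<lambda>Z. \<Phi> (Z(e := False)))"
    using assms by (simp add: UNIV_bool)
  finally show ?thesis
    by (simp add: int)
qed

section \<open>Scalar Bernstein estimate for a centred Bernoulli variable\<close>

definition bernoulli_cgf :: "real \<Rightarrow> real \<Rightarrow> real" where
  "bernoulli_cgf eps \<theta> = ln (1 + eps * (exp (2 * \<theta>) - 1)) - 2 * eps * \<theta>"

lemma bernoulli_cgf_arg_pos:
  fixes eps :: real
  assumes "0 \<le> eps" "eps < 1"
  shows "0 < 1 + eps * (exp (2 * \<theta>) - 1)"
proof -
  have "1 + eps * (exp (2 * \<theta>) - 1) = (1 - eps) + eps * exp (2 * \<theta>)"
    by (simp add: algebra_simps)
  moreover have "0 \<le> eps * exp (2 * \<theta>)"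
    using assms by simp
  ultimately show ?thesis using assms by linarith
qed

text \<open>\<open>bernoulli_cgf\<close> is the logarithmic moment generating function of
  \<open>2 * (Z - eps)\<close>, the 2 being the squared length of each \<open>p e\<close>. Its
  derivative is written as twice the coefficient in \<open>expectation_centered_le\<close>, to match
  the differential inequality.\<close>

lemma has_real_derivative_bernoulli_cgf:
  assumes "0 \<le> eps" "eps < 1"
  shows "(bernoulli_cgf eps has_real_derivative
    2 * (eps * (1 - eps) * (exp (2 * \<theta>) - 1) / (1 + eps * (exp (2 * \<theta>) - 1)))) (at \<theta>)"
proof -
  let ?D = "1 + eps * (exp (2 * \<theta>) - 1)"
  have pos: "0 < ?D" by (rule bernoulli_cgf_arg_pos[OF assms])
  have "(bernoulli_cgf eps has_real_derivative eps * (exp (2 * \<theta>) * 2) / ?D - 2 * eps) (at \<theta>)"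
    unfolding bernoulli_cgf_def using pos by (auto intro!: derivative_eq_intros)
  moreover have "eps * (exp (2 * \<theta>) * 2) / ?D - 2 * eps = (eps * (exp (2 * \<theta>) * 2) - 2 * eps * ?D) / ?D"
    using pos by (simp add: diff_divide_distrib)
  moreover have "eps * (exp (2 * \<theta>) * 2) - 2 * eps * ?D = 2 * (eps * (1 - eps) * (exp (2 * \<theta>) - 1))"
    by (simp add: algebra_simps)
  ultimately show ?thesis by simp
qed

text \<open>The difference \<open>h\<close> of the two sides has derivative \<open>k\<close>, which
  is nondecreasing because \<open>(1 - x) * exp x \<le> 1\<close>. As \<open>k 0 = 0\<close>, the
  function \<open>h\<close> attains its minimum \<open>h 0 = 0\<close> at 0.\<close>

lemma exp_minus_linear_le: "(exp x - 1 - x) * (1 - x / 3) \<le> x\<^sup>2 / 2" for x :: real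
proof -
  define h where "h x = x\<^sup>2 / 2 - (exp x - 1 - x) * (1 - x / 3)" for x :: real
  define k where "k x = (2 * x + (x - 2) * (exp x - 1)) / 3" for x :: real
  have h': "(h has_real_derivative k x) (at x)" for x
    unfolding h_def k_def by (auto intro!: derivative_eq_intros simp: field_simps)
  have k': "(k has_real_derivative (1 + (x - 1) * exp x) / 3) (at x)" for x
    unfolding k_def by (auto intro!: derivative_eq_intros simp: field_simps)
  have k'_nonneg: "0 \<le> (1 + (x - 1) * exp x) / 3" for x :: real
  proof -
    have "(1 - x) * exp x \<le> exp (- x) * exp x"
      using exp_ge_add_one_self[of "- x"] by (intro mult_right_mono) auto
    then show ?thesis by (simp add: exp_minus field_simps)
  qed
  have k_mono: "k x \<le> k y" if "x \<le> y" for x y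
    using that k' k'_nonneg by (meson DERIV_nonneg_imp_nondecreasing)
  have k0: "k 0 = 0" by (simp add: k_def)
  have "0 \<le> h x"
  proof (cases "0 \<le> x")
    case True
    have "h 0 \<le> h x"
    proof (rule DERIV_nonneg_imp_nondecreasing[OF True])
      show "\<exists>D. (h has_real_derivative D) (at y) \<and> 0 \<le> D" if "0 \<le> y" for y
        using h'[of y] k_mono[OF that] k0 by auto
    qed
    then show ?thesis by (simp add: h_def)
  next
    case False
    then have "x \<le> 0" by simp
    have "h 0 \<le> h x"
    proof (rule DERIV_nonpos_imp_nonincreasing[OF \<open>x \<le> 0\<close>])
      show "\<exists>D. (h has_real_derivative D) (at y) \<and> D \<le> 0" if "y \<le> 0" for y
        using h'[of y] k_mono[OF that] k0 by auto
    qed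
    then show ?thesis by (simp add: h_def)
  qed
  then show ?thesis by (simp add: h_def)
qed

lemma exp_minus_linear_le_uniform:
  fixes y z :: real
  assumes "y \<le> z" "z < 3"
  shows "exp y - 1 - y \<le> y\<^sup>2 / 2 / (1 - z / 3)"
proof -
  have "0 \<le> exp y - 1 - y"
    using exp_ge_add_one_self[of y] by linarith
  then have "(exp y - 1 - y) * (1 - z / 3) \<le> (exp y - 1 - y) * (1 - y / 3)"
    using assms by (intro mult_left_mono) auto
  also have "\<dots> \<le> y\<^sup>2 / 2" by (rule exp_minus_linear_le)
  finally show ?thesis
    using assms by (subst pos_le_divide_eq) auto
qed

text \<open>The two values of \<open>2 * \<theta> * (Z - eps)\<close> are \<open>y1\<close> and
  \<open>y0\<close>. After \<open>ln M \<le> M - 1\<close> the linear terms cancel because the mean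
  is zero, the quadratic terms add up to the variance, and the denominator of the larger value
  \<open>y1\<close> serves for both.\<close>

lemma bernoulli_cgf_le:
  fixes eps \<theta> :: real
  assumes "0 < eps" "eps < 1" "0 \<le> \<theta>" "2 * (1 - eps) * \<theta> < 3"
  shows "bernoulli_cgf eps \<theta> \<le> 2 * eps * (1 - eps) * \<theta>\<^sup>2 / (1 - 2 * (1 - eps) * \<theta> / 3)"
proof -
  let ?M = "1 + eps * (exp (2 * \<theta>) - 1)"
  define y1 where "y1 = 2 * (1 - eps) * \<theta>"
  define y0 where "y0 = - 2 * eps * \<theta>"
  have pos: "0 < ?M" using assms by (intro bernoulli_cgf_arg_pos) auto
  have "0 \<le> eps * \<theta>" "0 \<le> (1 - eps) * \<theta>" using assms by simp_all
  then have "y0 \<le> y1" unfolding y0_def y1_def by linarith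
  have "bernoulli_cgf eps \<theta> = ln (?M * exp y0)"
    using pos by (simp add: bernoulli_cgf_def ln_mult y0_def)
  also have "\<dots> \<le> ?M * exp y0 - 1"
    using pos by (intro ln_le_minus_one) auto
  also have "\<dots> = eps * (exp y1 - 1 - y1) + (1 - eps) * (exp y0 - 1 - y0)"
  proof -
    have "exp y1 = exp (2 * \<theta>) * exp y0"
      by (simp add: y0_def y1_def algebra_simps flip: exp_add)
    moreover have "eps * y1 + (1 - eps) * y0 = 0"
      by (simp add: y0_def y1_def algebra_simps)
    ultimately show ?thesis by (simp add: algebra_simps)
  qed
  also have "\<dots> \<le> eps * (y1\<^sup>2 / 2 / (1 - y1 / 3)) + (1 - eps) * (y0\<^sup>2 / 2 / (1 - y1 / 3))"
    using assms \<open>y0 \<le> y1\<close>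
    by (intro add_mono mult_left_mono exp_minus_linear_le_uniform) (auto simp: y1_def)
  also have "\<dots> = (eps * y1\<^sup>2 + (1 - eps) * y0\<^sup>2) / 2 / (1 - y1 / 3)"
    by (simp add: add_divide_distrib)
  also have "eps * y1\<^sup>2 + (1 - eps) * y0\<^sup>2 = 4 * eps * (1 - eps) * \<theta>\<^sup>2"
    by (simp add: y0_def y1_def power2_eq_square algebra_simps)
  finally show ?thesis by (simp add: y1_def)
qed

section \<open>Matrix Bernstein inequality through a differential inequality\<close>

locale bernoulli_frame =
  fixes n :: nat and S :: "'e set" and p q :: "'e \<Rightarrow> nat \<Rightarrow> real" and s eps \<kappa> :: real
  assumes finite_S: "finite S"
    and eps: "0 < eps" "eps < 1"
    and tight: "(\<Sum>e\<in>S. dot n (p e) x * dot n (p e) y) + (\<Sum>e\<in>S. dot n (q e) x * dot n (q e) y) = s * dot n x y"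
    and p_norm: "e \<in> S \<Longrightarrow> dot n (p e) (p e) = 2"
    and p_bound: "(\<Sum>e\<in>S. (dot n (p e) x)\<^sup>2) \<le> \<kappa> * dot n x x"
begin

definition weight :: "('e \<Rightarrow> bool) \<Rightarrow> 'e \<times> bool \<Rightarrow> real" where
  "weight Z = (\<lambda>(e, b). if b then of_bool (Z e) else eps)"

definition vector :: "'e \<times> bool \<Rightarrow> nat \<Rightarrow> real" where
  "vector = (\<lambda>(e, b). if b then p e else q e)"

lemma weight_simps [simp]:
  "weight Z (e, True) = of_bool (Z e)" "weight Z (e, False) = eps"
  by (simp_all add: weight_def)

lemma vector_simps [simp]: "vector (e, True) = p e" "vector (e, False) = q e"
  by (simp_all add: vector_def)

lemma frame_weight: "frame (S \<times> UNIV) (weight Z)"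
  using eps by unfold_locales (auto simp: weight_def)

text \<open>By tightness the operator \<open>Y.T Z\<close> is \<open>\<Sum>\<^sub>e (Z\<^sub>e - eps) p\<^sub>e p\<^sub>e\<^sup>\<top> + s eps I\<close>; writing the shift
  through the \<open>q\<^sub>e\<close> exhibits it as a nonnegative combination of rank-one projections.\<close>

sublocale Y: frame n "S \<times> UNIV" "weight Z" vector for Z
  by (rule frame_weight)

abbreviation noise :: "('e \<Rightarrow> bool) pmf" where
  "noise \<equiv> Pi_pmf S False (\<lambda>_. bernoulli_pmf eps)"

text \<open>The trace of the exponential of \<open>\<theta>\<close> times the shifted noise
  operator; the shift contributes only the scalar factor
  \<open>exp (s * eps * \<theta>)\<close>.\<close>

definition trace_exp :: "('e \<Rightarrow> bool) \<Rightarrow> real \<Rightarrow> real" where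
  "trace_exp Z \<theta> = (\<Sum>i<n. Y.exp_form Z (unit_vec i) \<theta>)"

lemma sum_S_bool: "(\<Sum>l\<in>S \<times> (UNIV :: bool set). f l) = (\<Sum>e\<in>S. f (e, True)) + (\<Sum>e\<in>S. f (e, False))"
  for f :: "'e \<times> bool \<Rightarrow> real"
  by (subst sum.cartesian_product') (simp add: UNIV_bool sum.distrib add.commute)

lemma dot_Y:
  "dot n x (Y.T Z x) = (\<Sum>e\<in>S. (of_bool (Z e) - eps) * (dot n (p e) x)\<^sup>2) + s * eps * dot n x x"
proof -
  have "dot n x (Y.T Z x) = (\<Sum>e\<in>S. of_bool (Z e) * (dot n (p e) x)\<^sup>2) + eps * (\<Sum>e\<in>S. (dot n (q e) x)\<^sup>2)"
    unfolding Y.dot_T_self sum_S_bool by (simp add: sum_distrib_left)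
  moreover have "(\<Sum>e\<in>S. (dot n (q e) x)\<^sup>2) = s * dot n x x - (\<Sum>e\<in>S. (dot n (p e) x)\<^sup>2)"
    using tight[of x x] by (simp add: power2_eq_square)
  ultimately show ?thesis
    by (simp add: algebra_simps sum_subtractf sum_distrib_left)
qed

text \<open>Cyclicity of the trace opens one factor of the operator; tightness then trades the
  \<open>q\<close>-terms for a multiple of the trace minus the \<open>p\<close>-terms.\<close>

lemma trace_Y_pow_Suc:
  "(\<Sum>i<n. Y.moment Z (unit_vec i) (Suc k))
    = (\<Sum>e\<in>S. (of_bool (Z e) - eps) * Y.moment Z (p e) k) + s * eps * (\<Sum>i<n. Y.moment Z (unit_vec i) k)"
proof -
  have expand: "(\<Sum>e\<in>S. Y.moment Z (r e) k)
      = (\<Sum>i<n. \<Sum>e\<in>S. dot n (r e) (unit_vec i) * dot n (r e) ((Y.T Z ^^ k) (unit_vec i)))" for r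
  proof -
    have "Y.moment Z u k = (\<Sum>i<n. dot n u (unit_vec i) * dot n u ((Y.T Z ^^ k) (unit_vec i)))" for u
      unfolding Y.moment_def
      by (subst sum_dot_unit[symmetric]) (simp add: Y.dot_T_pow_commute)
    then show ?thesis
      by (simp, subst sum.swap) simp
  qed
  have sum_pq: "(\<Sum>e\<in>S. Y.moment Z (p e) k) + (\<Sum>e\<in>S. Y.moment Z (q e) k)
      = s * (\<Sum>i<n. Y.moment Z (unit_vec i) k)"
    unfolding expand
    unfolding sum.distrib[symmetric, where A = "{..<n}"] sum.distrib[symmetric, where A = S]
    unfolding sum.distrib[where A = S] tight
    by (simp add: Y.moment_def sum_distrib_left)
  have "(\<Sum>e\<in>S. Y.moment Z (q e) k)
      = s * (\<Sum>i<n. Y.moment Z (unit_vec i) k) - (\<Sum>e\<in>S. Y.moment Z (p e) k)"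
    using sum_pq by linarith
  moreover have "(\<Sum>i<n. Y.moment Z (unit_vec i) (Suc k))
      = (\<Sum>e\<in>S. of_bool (Z e) * Y.moment Z (p e) k) + eps * (\<Sum>e\<in>S. Y.moment Z (q e) k)"
    unfolding Y.trace_pow_Suc sum_S_bool
    by (simp add: sum_distrib_left)
  ultimately have "(\<Sum>i<n. Y.moment Z (unit_vec i) (Suc k))
      = (\<Sum>e\<in>S. of_bool (Z e) * Y.moment Z (p e) k)
        + eps * (s * (\<Sum>i<n. Y.moment Z (unit_vec i) k) - (\<Sum>e\<in>S. Y.moment Z (p e) k))"
    by simp
  then show ?thesis
    by (simp add: algebra_simps sum_subtractf sum_distrib_left)
qed

text \<open>Termwise differentiation gives the trace of the operator times its exponential. The
  operator commutes with its own powers, so no noncommutative correction appears.\<close>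

lemma has_real_derivative_trace_exp:
  "(trace_exp Z has_real_derivative
     (\<Sum>e\<in>S. (of_bool (Z e) - eps) * Y.exp_form Z (p e) \<theta>) + s * eps * trace_exp Z \<theta>) (at \<theta>)"
proof -
  define c where "c i k = Y.moment Z (unit_vec i) k / fact k" for i k
  have sm: "summable (\<lambda>k. c i k * y ^ k)" for i y
    unfolding c_def by (rule Y.summable_exp_form)
  have D: "(trace_exp Z has_real_derivative (\<Sum>i<n. \<Sum>k. diffs (c i) k * \<theta> ^ k)) (at \<theta>)"
    unfolding trace_exp_def Y.exp_form_def c_def[symmetric]
    by (intro DERIV_sum termdiffs_strong_converges_everywhere sm)
  have sums1: "(\<lambda>k. \<Sum>i<n. diffs (c i) k * \<theta> ^ k) sums (\<Sum>i<n. \<Sum>k. diffs (c i) k * \<theta> ^ k)"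
    by (intro sums_sum summable_sums termdiff_converges_all sm)
  have coeff: "(\<Sum>i<n. diffs (c i) k * \<theta> ^ k)
      = (\<Sum>e\<in>S. (of_bool (Z e) - eps) * (Y.moment Z (p e) k / fact k * \<theta> ^ k))
        + s * eps * (\<Sum>i<n. Y.moment Z (unit_vec i) k / fact k * \<theta> ^ k)" for k
  proof -
    have "diffs (c i) k = Y.moment Z (unit_vec i) (Suc k) / fact k" for i
      by (simp add: diffs_def c_def field_simps del: of_nat_Suc)
    then have "(\<Sum>i<n. diffs (c i) k * \<theta> ^ k) = (\<Sum>i<n. Y.moment Z (unit_vec i) (Suc k)) * (\<theta> ^ k / fact k)"
      by (simp add: sum_distrib_right sum_divide_distrib)
    moreover have "(\<Sum>e\<in>S. (of_bool (Z e) - eps) * (Y.moment Z (p e) k / fact k * \<theta> ^ k))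
        = (\<Sum>e\<in>S. (of_bool (Z e) - eps) * Y.moment Z (p e) k) * (\<theta> ^ k / fact k)"
      by (simp add: sum_distrib_right sum_divide_distrib mult.assoc)
    ultimately show ?thesis
      unfolding trace_Y_pow_Suc Y.sum_scaled_moments
      by (simp only: distrib_right mult.assoc)
  qed
  have sums2: "(\<lambda>k. (\<Sum>e\<in>S. (of_bool (Z e) - eps) * (Y.moment Z (p e) k / fact k * \<theta> ^ k))
        + s * eps * (\<Sum>i<n. Y.moment Z (unit_vec i) k / fact k * \<theta> ^ k)) sums
      ((\<Sum>e\<in>S. (of_bool (Z e) - eps) * Y.exp_form Z (p e) \<theta>) + s * eps * trace_exp Z \<theta>)"
    unfolding trace_exp_def by (intro sums_add sums_mult sums_sum Y.exp_form_sums)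
  from D show ?thesis
    unfolding sums_unique2[OF sums1[unfolded coeff] sums2] .
qed

lemma exp_form_flip:
  assumes "e \<in> S" "0 \<le> \<theta>"
  shows "Y.exp_form (Z(e := True)) (p e) \<theta> \<le> exp (2 * \<theta>) * Y.exp_form (Z(e := False)) (p e) \<theta>"
proof -
  have "frame_op n (S \<times> UNIV) (weight (Z(e := True))) vector v
      = (\<lambda>i. Y.T (Z(e := False)) v i + dot n (p e) v * p e i)" for v
  proof
    fix i
    have "frame_op n (S \<times> UNIV) (weight (Z(e := True))) vector v i - Y.T (Z(e := False)) v i
        = (\<Sum>l\<in>S. if l = e then dot n (p e) v * p e i else 0)"
      unfolding frame_op_def sum_S_bool
      by (simp flip: sum_subtractf) (intro sum.cong refl, simp)
    also have "\<dots> = dot n (p e) v * p e i"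
      using assms finite_S by simp
    finally show "frame_op n (S \<times> UNIV) (weight (Z(e := True))) vector v i
        = Y.T (Z(e := False)) v i + dot n (p e) v * p e i"
      by simp
  qed
  from Y.exp_form_rank_one_update[OF frame_weight \<open>0 \<le> \<theta>\<close> this]
  show ?thesis
    by (simp add: p_norm assms)
qed

lemma finite_set_noise: "finite (set_pmf noise)"
  by (rule finite_set_Pi_bernoulli[OF finite_S])

lemma integrable_noise: "integrable (measure_pmf noise) f" for f :: "_ \<Rightarrow> real"
  using finite_set_noise by (rule integrable_measure_pmf_finite)

text \<open>Let \<open>x\<close> and \<open>y\<close> be the values of the form at
  \<open>Z e = True\<close> and \<open>Z e = False\<close>, the other coordinates being fixed. The
  centred mean is \<open>eps * (1 - eps) * (x - y)\<close>, and after clearing denominators its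
  comparison with the plain mean reduces to \<open>x \<le> a * y\<close>, which is
  \<open>exp_form_flip\<close>.\<close>

lemma expectation_centered_le:
  assumes "e \<in> S" "0 \<le> \<theta>"
  defines "a \<equiv> exp (2 * \<theta>)"
  shows "measure_pmf.expectation noise (\<lambda>Z. (of_bool (Z e) - eps) * Y.exp_form Z (p e) \<theta>)
    \<le> eps * (1 - eps) * (a - 1) / (1 + eps * (a - 1))
        * measure_pmf.expectation noise (\<lambda>Z. Y.exp_form Z (p e) \<theta>)"
proof -
  define r where "r = eps * (1 - eps) * (a - 1) / (1 + eps * (a - 1))"
  let ?R = "Pi_pmf (S - {e}) False (\<lambda>_. bernoulli_pmf eps)"
  have fin: "finite (set_pmf ?R)"
    using finite_S by (simp add: finite_set_Pi_bernoulli)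
  have pos: "0 < 1 + eps * (a - 1)"
    unfolding a_def using eps by (intro bernoulli_cgf_arg_pos) auto
  have "eps * ((1 - eps) * x) + (1 - eps) * (- eps * y) \<le> r * (eps * x + (1 - eps) * y)"
    if "x \<le> a * y" for x y :: real
  proof -
    have "(x - y) * (1 + eps * (a - 1)) \<le> (a - 1) * (eps * x + (1 - eps) * y)"
      using that by (simp add: algebra_simps)
    then have "eps * (1 - eps) * ((x - y) * (1 + eps * (a - 1)))
        \<le> eps * (1 - eps) * ((a - 1) * (eps * x + (1 - eps) * y))"
      using eps by (intro mult_left_mono) auto
    then have "eps * (1 - eps) * (x - y) \<le> eps * (1 - eps) * ((a - 1) * (eps * x + (1 - eps) * y)) / (1 + eps * (a - 1))"
      using pos by (simp add: pos_le_divide_eq mult_ac)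
    then show ?thesis by (simp add: r_def algebra_simps)
  qed
  then have pointwise: "eps * ((1 - eps) * Y.exp_form (Z(e := True)) (p e) \<theta>)
        + (1 - eps) * (- eps * Y.exp_form (Z(e := False)) (p e) \<theta>)
      \<le> r * (eps * Y.exp_form (Z(e := True)) (p e) \<theta> + (1 - eps) * Y.exp_form (Z(e := False)) (p e) \<theta>)" for Z
    using exp_form_flip[OF assms(1,2)] unfolding a_def by blast
  have "measure_pmf.expectation noise (\<lambda>Z. (of_bool (Z e) - eps) * Y.exp_form Z (p e) \<theta>)
      = measure_pmf.expectation ?R (\<lambda>Z. eps * ((1 - eps) * Y.exp_form (Z(e := True)) (p e) \<theta>)
          + (1 - eps) * (- eps * Y.exp_form (Z(e := False)) (p e) \<theta>))"
    using expectation_Pi_bernoulli_split[OF finite_S assms(1), of eps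
        "\<lambda>Z. (of_bool (Z e) - eps) * Y.exp_form Z (p e) \<theta>"] eps
    by simp
  also have "\<dots> \<le> measure_pmf.expectation ?R (\<lambda>Z. r * (eps * Y.exp_form (Z(e := True)) (p e) \<theta>
          + (1 - eps) * Y.exp_form (Z(e := False)) (p e) \<theta>))"
    by (intro integral_mono integrable_measure_pmf_finite fin pointwise)
  also have "\<dots> = r * measure_pmf.expectation noise (\<lambda>Z. Y.exp_form Z (p e) \<theta>)"
    using expectation_Pi_bernoulli_split[OF finite_S assms(1), of eps "\<lambda>Z. Y.exp_form Z (p e) \<theta>"] eps
    unfolding integral_mult_right_zero by simp
  finally show ?thesis unfolding r_def .
qed

lemma trace_exp_0: "trace_exp Z 0 = real n"
proof -
  have "Y.exp_form Z (unit_vec i) 0 = 1" if "i < n" for i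
    using that powser_zero[of "\<lambda>k. Y.moment Z (unit_vec i) k / fact k"]
    by (simp add: Y.exp_form_def Y.moment_0 dot_unit_right) (simp add: unit_vec_def)
  then show ?thesis by (simp add: trace_exp_def)
qed

text \<open>Summing the edgewise estimates and bounding the sum of the forms by
  \<open>\<kappa>\<close> times the trace gives \<open>m' \<le> c' * m\<close>, where
  \<open>c\<close> is the exponent in the claim.\<close>

lemma expectation_trace_exp_le:
  assumes "0 \<le> \<theta>"
  shows "measure_pmf.expectation noise (\<lambda>Z. trace_exp Z \<theta>)
    \<le> real n * exp (s * eps * \<theta> + \<kappa> / 2 * bernoulli_cgf eps \<theta>)"
proof -
  define m where "m \<theta> = measure_pmf.expectation noise (\<lambda>Z. trace_exp Z \<theta>)" for \<theta>
  define m' where "m' \<theta> = measure_pmf.expectation noise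
    (\<lambda>Z. (\<Sum>e\<in>S. (of_bool (Z e) - eps) * Y.exp_form Z (p e) \<theta>) + s * eps * trace_exp Z \<theta>)" for \<theta>
  define r where "r \<theta> = eps * (1 - eps) * (exp (2 * \<theta>) - 1) / (1 + eps * (exp (2 * \<theta>) - 1))" for \<theta>
  have fin_sum: "measure_pmf.expectation noise f = (\<Sum>Z\<in>set_pmf noise. pmf noise Z * f Z)" for f :: "_ \<Rightarrow> real"
    using integral_measure_pmf[OF finite_set_noise, of noise f] by simp
  have m_deriv: "(m has_real_derivative m' \<theta>) (at \<theta>)" for \<theta>
    unfolding m_def m'_def fin_sum
    by (intro DERIV_sum DERIV_cmult has_real_derivative_trace_exp)
  have m'_le: "m' \<theta> \<le> (s * eps + \<kappa> * r \<theta>) * m \<theta>" if "0 \<le> \<theta>" for \<theta>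
  proof -
    have r: "0 \<le> r \<theta>"
      unfolding r_def using eps that bernoulli_cgf_arg_pos[of eps \<theta>] by (auto intro!: divide_nonneg_pos)
    have "m' \<theta> = (\<Sum>e\<in>S. measure_pmf.expectation noise (\<lambda>Z. (of_bool (Z e) - eps) * Y.exp_form Z (p e) \<theta>))
        + s * eps * m \<theta>"
      unfolding m'_def m_def by (simp add: integrable_noise)
    also have "\<dots> \<le> (\<Sum>e\<in>S. r \<theta> * measure_pmf.expectation noise (\<lambda>Z. Y.exp_form Z (p e) \<theta>)) + s * eps * m \<theta>"
      unfolding r_def by (intro add_right_mono sum_mono expectation_centered_le that)
    also have "\<dots> = r \<theta> * measure_pmf.expectation noise (\<lambda>Z. \<Sum>e\<in>S. Y.exp_form Z (p e) \<theta>) + s * eps * m \<theta>"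
      by (simp add: integrable_noise sum_distrib_left)
    also have "\<dots> \<le> r \<theta> * measure_pmf.expectation noise (\<lambda>Z. \<kappa> * trace_exp Z \<theta>) + s * eps * m \<theta>"
      unfolding trace_exp_def
      by (intro add_right_mono mult_left_mono integral_mono integrable_noise r
          Y.sum_exp_form_le_trace that p_bound)
    also have "\<dots> = (s * eps + \<kappa> * r \<theta>) * m \<theta>"
      by (simp add: m_def algebra_simps)
    finally show ?thesis .
  qed
  define c where "c \<theta> = s * eps * \<theta> + \<kappa> / 2 * bernoulli_cgf eps \<theta>" for \<theta>
  have c_deriv: "(c has_real_derivative s * eps + \<kappa> * r \<theta>) (at \<theta>)" for \<theta>
  proof -
    have "(bernoulli_cgf eps has_real_derivative 2 * r \<theta>) (at \<theta>)"
      unfolding r_def using eps by (intro has_real_derivative_bernoulli_cgf) auto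
    then show ?thesis
      unfolding c_def by (auto intro!: derivative_eq_intros)
  qed
  \<comment> \<open>Gronwall: the quotient of \<open>m\<close> by \<open>exp c\<close> is
    nonincreasing, and at 0 it equals the dimension.\<close>
  have "m \<theta> * exp (- c \<theta>) \<le> m 0 * exp (- c 0)"
  proof (rule DERIV_nonpos_imp_nonincreasing[OF assms])
    fix x :: real assume "0 \<le> x"
    have "((\<lambda>x. m x * exp (- c x)) has_real_derivative
        (m' x - (s * eps + \<kappa> * r x) * m x) * exp (- c x)) (at x)"
      by (auto intro!: derivative_eq_intros m_deriv c_deriv simp: algebra_simps)
    moreover have "(m' x - (s * eps + \<kappa> * r x) * m x) * exp (- c x) \<le> 0"
      using m'_le[OF \<open>0 \<le> x\<close>] by (simp add: mult_nonpos_nonneg)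
    ultimately show "\<exists>D. ((\<lambda>x. m x * exp (- c x)) has_real_derivative D) (at x) \<and> D \<le> 0"
      by blast
  qed
  also have "m 0 * exp (- c 0) = real n"
    by (simp add: m_def trace_exp_0 c_def bernoulli_cgf_def)
  finally show ?thesis
    unfolding m_def[symmetric] c_def[symmetric] by (simp add: exp_minus field_simps)
qed

theorem bernstein_rank_one:
  assumes "0 < \<kappa>" "0 \<le> t"
  shows "measure_pmf.prob noise
      {Z. \<exists>x. 0 < dot n x x \<and> t * dot n x x \<le> (\<Sum>e\<in>S. (of_bool (Z e) - eps) * (dot n (p e) x)\<^sup>2)}
    \<le> real n * exp (- (t\<^sup>2 / 2) / (2 * \<kappa> * eps * (1 - eps) + 2 * (1 - eps) * t / 3))"
    (is "measure_pmf.prob noise ?bad \<le> _")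
proof -
  \<comment> \<open>\<open>V\<close> bounds the matrix variance, since the square of
    \<open>p\<^sub>e p\<^sub>e\<^sup>\<top>\<close> is twice itself; \<open>b\<close> bounds the
    largest eigenvalue of a single summand.\<close>
  define V where "V = 2 * \<kappa> * eps * (1 - eps)"
  define b where "b = 2 * (1 - eps)"
  \<comment> \<open>Bernstein's choice: it makes the cumulant bound equal to half of
    \<open>\<theta> * t\<close>.\<close>
  define \<theta> where "\<theta> = t / (V + b * t / 3)"
  have V: "0 < V" and b: "0 < b" using assms eps by (simp_all add: V_def b_def)
  have denom: "0 < V + b * t / 3"
    using V b assms by (simp add: add_pos_nonneg)
  have \<theta>: "0 \<le> \<theta>" unfolding \<theta>_def using assms denom by simp
  have one_minus: "1 - b * \<theta> / 3 = V / (V + b * t / 3)"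
    unfolding \<theta>_def using denom by (simp add: field_simps)
  then have "0 < 1 - b * \<theta> / 3" using V denom by simp
  then have b\<theta>: "b * \<theta> < 3" by simp
  have cgf: "\<kappa> / 2 * bernoulli_cgf eps \<theta> \<le> t\<^sup>2 / 2 / (V + b * t / 3)"
  proof -
    have "\<kappa> / 2 * bernoulli_cgf eps \<theta> \<le> \<kappa> / 2 * (2 * eps * (1 - eps) * \<theta>\<^sup>2 / (1 - b * \<theta> / 3))"
      using bernoulli_cgf_le[OF eps \<theta>] b\<theta> assms(1) by (intro mult_left_mono) (auto simp: b_def)
    also have "\<dots> = V * \<theta>\<^sup>2 / 2 / (1 - b * \<theta> / 3)"
      by (simp add: V_def)
    also have "\<dots> = \<theta>\<^sup>2 * (V + b * t / 3) / 2"
      unfolding one_minus using V denom by simp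
    also have "\<dots> = t\<^sup>2 / 2 / (V + b * t / 3)"
      unfolding \<theta>_def using denom by (simp add: power2_eq_square)
    finally show ?thesis .
  qed
  have bad: "exp (\<theta> * (s * eps + t)) \<le> trace_exp Z \<theta>" if Z_bad: "Z \<in> ?bad" for Z
  proof -
    obtain x where x: "0 < dot n x x" "t * dot n x x \<le> (\<Sum>e\<in>S. (of_bool (Z e) - eps) * (dot n (p e) x)\<^sup>2)"
      using Z_bad by blast
    \<comment> \<open>\<open>exp_le_trace\<close> asks for a nonnegative threshold, here
      \<open>s * eps + t\<close>; tightness at \<open>x\<close> shows
      \<open>0 \<le> s\<close>.\<close>
    have "0 \<le> s * dot n x x"
      unfolding tight[of x x, symmetric] by (intro add_nonneg_nonneg sum_nonneg) simp_all
    with x(1) have "0 \<le> s" by (simp add: zero_le_mult_iff)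
    then show ?thesis
      unfolding trace_exp_def using x eps assms \<theta>
      by (intro Y.exp_le_trace[of x]) (simp_all add: dot_Y algebra_simps)
  qed
  have "measure_pmf.prob noise ?bad = measure_pmf.expectation noise (indicator ?bad)"
    by simp
  also have "\<dots> \<le> measure_pmf.expectation noise (\<lambda>Z. exp (- (\<theta> * (s * eps + t))) * trace_exp Z \<theta>)"
  proof (rule integral_mono[OF integrable_noise integrable_noise])
    fix Z
    have "0 \<le> trace_exp Z \<theta>"
      unfolding trace_exp_def by (intro sum_nonneg Y.exp_form_nonneg \<theta>)
    moreover have "1 \<le> exp (- (\<theta> * (s * eps + t))) * trace_exp Z \<theta>" if "Z \<in> ?bad"
      using mult_left_mono[OF bad[OF that], of "exp (- (\<theta> * (s * eps + t)))"]
      by (simp flip: exp_add)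
    ultimately show "indicator ?bad Z \<le> exp (- (\<theta> * (s * eps + t))) * trace_exp Z \<theta>"
      by (simp only: indicator_def split: if_splits) simp
  qed
  also have "\<dots> \<le> exp (- (\<theta> * (s * eps + t))) * (real n * exp (s * eps * \<theta> + \<kappa> / 2 * bernoulli_cgf eps \<theta>))"
    using expectation_trace_exp_le[OF \<theta>] by simp
  also have "\<dots> = real n * exp (\<kappa> / 2 * bernoulli_cgf eps \<theta> - \<theta> * t)"
    by (simp add: algebra_simps flip: exp_add)
  also have "\<dots> \<le> real n * exp (t\<^sup>2 / 2 / (V + b * t / 3) - \<theta> * t)"
    using cgf by (intro mult_left_mono) auto
  also have "t\<^sup>2 / 2 / (V + b * t / 3) - \<theta> * t = - (t\<^sup>2 / 2) / (V + b * t / 3)"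
  proof -
    have "t\<^sup>2 / 2 / D - t / D * t = - (t\<^sup>2 / 2) / D" if "0 < D" for D
      using that by (simp add: field_simps power2_eq_square)
    from this[OF denom] show ?thesis unfolding \<theta>_def .
  qed
  finally show ?thesis unfolding V_def b_def .
qed

end

section \<open>Dual certificate for the semidefinite program\<close>

lemma quad_form_Suc:
  assumes sym: "\<And>i. i < n \<Longrightarrow> X i n = X n i"
  shows "quad_form (Suc n) X v = quad_form n X v + 2 * v n * (\<Sum>i<n. X n i * v i) + X n n * (v n)\<^sup>2"
proof -
  have "(\<Sum>i<n. v i * X i n * v n) = v n * (\<Sum>i<n. X n i * v i)"
    by (simp add: sum_distrib_left sym mult_ac)
  then show ?thesis
    by (simp add: quad_form_def sum.distrib sum_distrib_left power2_eq_square mult_ac)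
qed

lemma quad_form_cong: "(\<And>i. i < n \<Longrightarrow> v i = v' i) \<Longrightarrow> quad_form n X v = quad_form n X v'"
  unfolding quad_form_def by (intro sum.cong) auto

text \<open>Cholesky factorisation: the last row supplies one vector, and the Schur complement of
  the last diagonal entry is handled by induction.\<close>

lemma psd_gram_decomposition:
  assumes "psd n X"
  shows "\<exists>w :: nat \<Rightarrow> nat \<Rightarrow> real. \<forall>i<n. \<forall>j<n. X i j = (\<Sum>l<n. w l i * w l j)"
  using assms
proof (induction n arbitrary: X)
  case 0
  then show ?case by simp
next
  case (Suc n)
  have sym: "X i j = X j i" if "i \<le> n" "j \<le> n" for i j
    using Suc.prems that by (auto simp: psd_def less_Suc_eq_le)
  define a where "a = X n n"
  define c where "c v = (\<Sum>i<n. X n i * v i)" for v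
  have quad: "0 \<le> quad_form n X v + 2 * y * c v + a * y\<^sup>2" for v y
  proof -
    have "0 \<le> quad_form (Suc n) X (v(n := y))"
      using Suc.prems by (simp add: psd_def)
    also have "\<dots> = quad_form n X (v(n := y)) + 2 * y * c v + a * y\<^sup>2"
      by (subst quad_form_Suc) (auto simp: sym a_def c_def)
    also have "quad_form n X (v(n := y)) = quad_form n X v"
      by (rule quad_form_cong) simp
    finally show ?thesis .
  qed
  have a: "0 \<le> a"
    using quad[of "\<lambda>_. 0" 1] by (simp add: quad_form_def c_def)
  \<comment> \<open>With a zero pivot the form is affine in \<open>y\<close>; a nonzero slope would
    allow the value -1, which the chosen \<open>y\<close> attains.\<close>
  have c_0: "c v = 0" if "a = 0" for v
  proof (rule ccontr)
    assume "c v \<noteq> 0"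
    then show False
      using quad[of v "- (quad_form n X v + 1) / (2 * c v)"] that by (simp add: field_simps)
  qed
  have row_0: "X n i = 0" if "a = 0" "i < n" for i
    using c_0[OF that(1), of "\<lambda>j. of_bool (j = i)"] that by (simp add: c_def)
  \<comment> \<open>For \<open>a = 0\<close> division by zero leaves \<open>X' = X\<close>, which is
    right because the row vanishes in that case.\<close>
  define X' where "X' i j = X i j - X n i * X n j / a" for i j
  have quad': "quad_form n X' v = quad_form n X v - (c v)\<^sup>2 / a" for v
  proof -
    have "(c v)\<^sup>2 / a = (\<Sum>i<n. \<Sum>j<n. v i * (X n i * X n j / a) * v j)"
      by (simp add: c_def power2_eq_square sum_product sum_divide_distrib mult_ac)
    then show ?thesis
      by (simp add: quad_form_def X'_def algebra_simps sum_subtractf)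
  qed
  have "psd n X'"
    unfolding psd_def
  proof (intro conjI allI impI)
    fix v
    show "0 \<le> quad_form n X' v"
    proof (cases "a = 0")
      case True
      then show ?thesis using quad[of v 0] by (simp add: quad')
    next
      case False
      then show ?thesis
        using quad[of v "- c v / a"] by (simp add: quad' power2_eq_square field_simps)
    qed
  qed (simp add: X'_def sym)
  then obtain w where w: "\<And>i j. i < n \<Longrightarrow> j < n \<Longrightarrow> X' i j = (\<Sum>l<n. w l i * w l j)"
    using Suc.IH by blast
  define w' where "w' l i = (if l = n then X n i / sqrt a else if i = n then 0 else w l i)" for l i
  show ?case
  proof (intro exI allI impI)
    fix i j assume "i < Suc n" "j < Suc n"
    then consider "i < n" "j < n" | "i = n" "j \<le> n" | "i < n" "j = n" by linarith
    then show "X i j = (\<Sum>l<Suc n. w' l i * w' l j)"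
    proof cases
      case 1
      then have "(\<Sum>l<n. w' l i * w' l j) = X' i j"
        by (simp add: w w'_def)
      then show ?thesis
        using a by (simp add: w'_def X'_def)
    next
      case 2
      then have "(\<Sum>l<n. w' l i * w' l j) = 0" by (simp add: w'_def)
      then show ?thesis
        using 2 a row_0[of j] by (cases "a = 0") (auto simp: w'_def a_def le_less)
    next
      case 3
      then have "(\<Sum>l<n. w' l i * w' l j) = 0" by (simp add: w'_def)
      then show ?thesis
        using 3 a row_0[of i] sym[of i n] by (cases "a = 0") (auto simp: w'_def a_def)
    qed
  qed
qed

text \<open>For a feasible \<open>X\<close>, conjugate its Gram vectors by the signs to get
  \<open>u\<close>. The gap to the objective at the sign matrix is then half the sum of the
  Laplacian forms \<open>Q (u l)\<close>, hence nonnegative. A zero gap makes every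
  \<open>u l\<close> constant on the vertices, and the unit diagonal then determines
  \<open>X\<close>.\<close>

lemma sdp_unique_opt_signs:
  fixes B W :: "nat \<Rightarrow> nat \<Rightarrow> real" and g :: "nat \<Rightarrow> real"
  assumes g: "\<And>i. g i * g i = 1"
    and W: "\<And>i j. i < n \<Longrightarrow> j < n \<Longrightarrow> W i j = g i * g j * B i j"
    and pos: "\<And>v i j. i < n \<Longrightarrow> j < n \<Longrightarrow> v i \<noteq> v j \<Longrightarrow> 0 < (\<Sum>i<n. \<Sum>j<n. B i j * (v i - v j)\<^sup>2)"
  shows "sdp_unique_opt n W (\<lambda>i j. g i * g j)"
proof -
  define Q where "Q v = (\<Sum>i<n. \<Sum>j<n. B i j * (v i - v j)\<^sup>2)" for v :: "nat \<Rightarrow> real"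
  have Q_nonneg: "0 \<le> Q v" for v
  proof (cases "\<exists>i<n. \<exists>j<n. v i \<noteq> v j")
    case True
    then obtain i j where "i < n" "j < n" "v i \<noteq> v j" by blast
    from pos[OF this] show ?thesis unfolding Q_def by (rule less_imp_le)
  next
    case False
    then obtain c where "\<And>i. i < n \<Longrightarrow> v i = c" by metis
    then have "Q v = 0"
      unfolding Q_def by simp
    then show ?thesis by simp
  qed
  have "quad_form n (\<lambda>i j. g i * g j) v = (\<Sum>i<n. g i * v i)\<^sup>2" for v
    by (simp add: quad_form_def power2_eq_square sum_product mult_ac)
  then have feasible: "sdp_feasible n (\<lambda>i j. g i * g j)"
    by (simp add: sdp_feasible_def psd_def g mult.commute)
  have main: "\<exists>u. tr_prod n W (\<lambda>i j. g i * g j) - tr_prod n W X = (\<Sum>l<n. Q (u l)) / 2 \<and>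
      (\<forall>i<n. (\<Sum>l<n. u l i * u l i) = 1) \<and> (\<forall>i<n. \<forall>j<n. X i j = g i * g j * (\<Sum>l<n. u l i * u l j))"
    if X: "sdp_feasible n X" for X
  proof -
    obtain w where w: "\<And>i j. i < n \<Longrightarrow> j < n \<Longrightarrow> X i j = (\<Sum>l<n. w l i * w l j)"
      using psd_gram_decomposition[of n X] X unfolding sdp_feasible_def by blast
    define u where "u l i = g i * w l i" for l i
    have gg: "g i * (g i * y) = y" for i y
      using g[of i] by (simp flip: mult.assoc)
    have uu: "(\<Sum>l<n. u l i * u l j) = g i * g j * X i j" if "i < n" "j < n" for i j
      using that by (simp add: w u_def sum_distrib_left mult_ac)
    have one: "(\<Sum>l<n. u l i * u l i) = 1" if "i < n" for i
      using that X by (simp add: uu g sdp_feasible_def)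
    have Xu: "X i j = g i * g j * (\<Sum>l<n. u l i * u l j)" if "i < n" "j < n" for i j
      using that by (simp add: uu gg mult_ac)
    have "(\<Sum>l<n. Q (u l)) = (\<Sum>i<n. \<Sum>j<n. B i j * (\<Sum>l<n. (u l i - u l j)\<^sup>2))"
      unfolding Q_def sum_distrib_left
      by (subst sum.swap) (intro sum.cong[OF refl] sum.swap)
    also have "\<dots> = (\<Sum>i<n. \<Sum>j<n. 2 * (W i j * (g j * g i) - W i j * X j i))"
    proof (intro sum.cong refl)
      fix i j assume ij: "i \<in> {..<n}" "j \<in> {..<n}"
      have "(\<Sum>l<n. (u l i - u l j)\<^sup>2)
          = (\<Sum>l<n. u l i * u l i) + (\<Sum>l<n. u l j * u l j) - 2 * (\<Sum>l<n. u l j * u l i)"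
        by (simp add: power2_eq_square algebra_simps sum.distrib sum_subtractf sum_distrib_left)
      also have "\<dots> = 2 - 2 * (g i * g j * X j i)"
      proof -
        have "i < n" "j < n" using ij by auto
        then show ?thesis
          unfolding one[OF \<open>i < n\<close>] one[OF \<open>j < n\<close>] uu[OF \<open>j < n\<close> \<open>i < n\<close>] by simp
      qed
      finally have sq: "(\<Sum>l<n. (u l i - u l j)\<^sup>2) = 2 - 2 * (g i * g j * X j i)" .
      show "B i j * (\<Sum>l<n. (u l i - u l j)\<^sup>2) = 2 * (W i j * (g j * g i) - W i j * X j i)"
        using ij unfolding sq by (simp add: W gg algebra_simps)
    qed
    also have "\<dots> = 2 * (tr_prod n W (\<lambda>i j. g i * g j) - tr_prod n W X)"
      by (simp add: tr_prod_def sum_distrib_left sum_subtractf right_diff_distrib)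
    finally show ?thesis
      using one Xu by (intro exI[of _ u]) auto
  qed
  show ?thesis
    unfolding sdp_unique_opt_def
  proof (intro conjI allI impI feasible)
    fix X assume "sdp_feasible n X"
    then obtain u where "tr_prod n W (\<lambda>i j. g i * g j) - tr_prod n W X = (\<Sum>l<n. Q (u l)) / 2"
      using main by blast
    moreover have "0 \<le> (\<Sum>l<n. Q (u l))"
      by (intro sum_nonneg Q_nonneg)
    ultimately show "tr_prod n W X \<le> tr_prod n W (\<lambda>i j. g i * g j)" by simp
  next
    fix X i j
    assume X: "sdp_feasible n X \<and> tr_prod n W X = tr_prod n W (\<lambda>i j. g i * g j)" and ij: "i < n" "j < n"
    then obtain u where u: "(\<Sum>l<n. Q (u l)) = 0" "(\<Sum>l<n. u l i * u l i) = 1"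
        "X i j = g i * g j * (\<Sum>l<n. u l i * u l j)"
      using main[of X] by auto
    have "Q (u l) = 0" if "l < n" for l
      using u(1) that by (subst (asm) sum_nonneg_eq_0_iff) (auto intro: Q_nonneg)
    then have "u l j = u l i" if "l < n" for l
      using pos[of i j "u l"] ij that unfolding Q_def by force
    then have "(\<Sum>l<n. u l i * u l j) = (\<Sum>l<n. u l i * u l i)"
      by simp
    then show "X i j = g i * g j" by (simp add: u)
  qed
qed

section \<open>Laplacian of a regular graph\<close>

definition edge_diff :: "nat \<times> nat \<Rightarrow> nat \<Rightarrow> real" where
  "edge_diff e = (\<lambda>k. unit_vec (fst e) k - unit_vec (snd e) k)"

text \<open>Edge differences generate the Laplacian \<open>d I - A\<close>, edge sums the signless
  Laplacian \<open>d I + A\<close>. Together they give \<open>2 d I\<close>, the tightness required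
  by \<open>bernoulli_frame\<close>.\<close>

definition edge_sum :: "nat \<times> nat \<Rightarrow> nat \<Rightarrow> real" where
  "edge_sum e = (\<lambda>k. unit_vec (fst e) k + unit_vec (snd e) k)"

lemma dot_edge_diff: "i < n \<Longrightarrow> j < n \<Longrightarrow> dot n (edge_diff (i, j)) x = x i - x j"
  by (simp add: edge_diff_def dot_def unit_vec_def left_diff_distrib sum_subtractf)

lemma dot_edge_sum: "i < n \<Longrightarrow> j < n \<Longrightarrow> dot n (edge_sum (i, j)) x = x i + x j"
  by (simp add: edge_sum_def dot_def unit_vec_def distrib_right sum.distrib)

locale regular_graph =
  fixes n d :: nat and E :: "nat \<Rightarrow> nat \<Rightarrow> bool"
  assumes n2: "n \<ge> 2" and d1: "d \<ge> 1"
    and G: "simple_graph n E" and reg: "regular n E d"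
begin

lemma edgeD: "(i, j) \<in> edge_set E \<Longrightarrow> i < n \<and> j < n \<and> i < j"
  using G by (auto simp: edge_set_def simple_graph_def)

lemma finite_edge_set: "finite (edge_set E)"
  by (rule finite_subset[of _ "{..<n} \<times> {..<n}"]) (use edgeD in auto)

lemma sum_adj_eq_sum_edges:
  "(\<Sum>i<n. \<Sum>j<n. adj E i j * F i j) = (\<Sum>(i, j)\<in>edge_set E. F i j + F j i)"
proof -
  let ?S = "edge_set E"
  have "(\<Sum>i<n. \<Sum>j<n. adj E i j * F i j) = (\<Sum>(i, j)\<in>{..<n} \<times> {..<n}. adj E i j * F i j)"
    by (rule sum.cartesian_product)
  also have "\<dots> = (\<Sum>(i, j)\<in>{(i, j). E i j}. F i j)"
    using G unfolding simple_graph_def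
    by (intro sum.mono_neutral_cong_right) (auto simp: adj_def split: if_splits)
  also have "{(i, j). E i j} = ?S \<union> prod.swap ` ?S"
  proof -
    have "(i, j) \<in> ?S \<union> prod.swap ` ?S \<longleftrightarrow> E i j" for i j
    proof -
      have "(i, j) \<in> prod.swap ` ?S \<longleftrightarrow> (j, i) \<in> ?S" by force
      then show ?thesis
        using G unfolding simple_graph_def edge_set_def
        by (cases i j rule: linorder_cases) auto
    qed
    then show ?thesis by blast
  qed
  also have "(\<Sum>(i, j)\<in>?S \<union> prod.swap ` ?S. F i j) = (\<Sum>(i, j)\<in>?S. F i j) + (\<Sum>(i, j)\<in>prod.swap ` ?S. F i j)"
  proof (rule sum.union_disjoint)
    show "?S \<inter> prod.swap ` ?S = {}"
      by (auto, metis edgeD less_asym)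
  qed (simp_all add: finite_edge_set)
  also have "(\<Sum>(i, j)\<in>prod.swap ` ?S. F i j) = (\<Sum>(i, j)\<in>?S. F j i)"
    by (subst sum.reindex) (auto simp: case_prod_beta)
  finally show ?thesis
    by (simp add: sum.distrib case_prod_beta)
qed

lemma sum_adj_row: "i < n \<Longrightarrow> (\<Sum>j<n. adj E i j) = real d"
proof -
  assume "i < n"
  have "(\<Sum>j<n. adj E i j) = (\<Sum>j\<in>{j. j < n \<and> E i j}. 1)"
    unfolding adj_def by (rule sum.mono_neutral_cong_right) auto
  then show ?thesis
    using reg \<open>i < n\<close> by (simp add: regular_def)
qed

lemma sum_adj_diag: "(\<Sum>i<n. \<Sum>j<n. adj E i j * (x i * y i)) = real d * dot n x y"
  by (simp add: sum_adj_row dot_def sum_distrib_left flip: sum_distrib_right)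

lemma sum_edge_diff:
  "(\<Sum>e\<in>edge_set E. dot n (edge_diff e) x * dot n (edge_diff e) y)
    = real d * dot n x y - (\<Sum>i<n. \<Sum>j<n. adj E i j * (x i * y j))"
proof -
  have "(\<Sum>e\<in>edge_set E. dot n (edge_diff e) x * dot n (edge_diff e) y)
      = (\<Sum>(i, j)\<in>edge_set E. (x i * y i - x i * y j) + (x j * y j - x j * y i))"
    by (intro sum.cong refl) (auto simp: dot_edge_diff algebra_simps dest!: edgeD)
  also have "\<dots> = (\<Sum>i<n. \<Sum>j<n. adj E i j * (x i * y i - x i * y j))"
    by (rule sum_adj_eq_sum_edges[symmetric])
  also have "\<dots> = (\<Sum>i<n. \<Sum>j<n. adj E i j * (x i * y i)) - (\<Sum>i<n. \<Sum>j<n. adj E i j * (x i * y j))"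
    by (simp add: right_diff_distrib sum_subtractf)
  finally show ?thesis by (simp add: sum_adj_diag)
qed

lemma sum_edge_sum:
  "(\<Sum>e\<in>edge_set E. dot n (edge_sum e) x * dot n (edge_sum e) y)
    = real d * dot n x y + (\<Sum>i<n. \<Sum>j<n. adj E i j * (x i * y j))"
proof -
  have "(\<Sum>e\<in>edge_set E. dot n (edge_sum e) x * dot n (edge_sum e) y)
      = (\<Sum>(i, j)\<in>edge_set E. (x i * y i + x i * y j) + (x j * y j + x j * y i))"
    by (intro sum.cong refl) (auto simp: dot_edge_sum algebra_simps dest!: edgeD)
  also have "\<dots> = (\<Sum>i<n. \<Sum>j<n. adj E i j * (x i * y i + x i * y j))"
    by (rule sum_adj_eq_sum_edges[symmetric])
  also have "\<dots> = (\<Sum>i<n. \<Sum>j<n. adj E i j * (x i * y i)) + (\<Sum>i<n. \<Sum>j<n. adj E i j * (x i * y j))"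
    by (simp add: distrib_left sum.distrib)
  finally show ?thesis by (simp add: sum_adj_diag)
qed

section \<open>Spectral bounds for the Laplacian form\<close>

definition laplacian_form :: "(nat \<Rightarrow> real) \<Rightarrow> real" where
  "laplacian_form x = (\<Sum>e\<in>edge_set E. (dot n (edge_diff e) x)\<^sup>2)"

lemma laplacian_form_nonneg: "0 \<le> laplacian_form x"
  unfolding laplacian_form_def by (intro sum_nonneg) simp

lemma quad_form_adj: "quad_form n (adj E) x = real d * dot n x x - laplacian_form x"
  using sum_edge_diff[of x x]
  by (simp add: laplacian_form_def quad_form_def power2_eq_square mult_ac)

text \<open>The signless Laplacian is positive semidefinite. This bounds the negated Rayleigh
  quotients, so that the supremum defining \<open>abs_lambda_n\<close> is an upper bound for
  them.\<close>

lemma quad_form_adj_ge: "- (real d * dot n x x) \<le> quad_form n (adj E) x"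
proof -
  have "0 \<le> (\<Sum>e\<in>edge_set E. dot n (edge_sum e) x * dot n (edge_sum e) x)"
    by (intro sum_nonneg) simp
  then show ?thesis
    using sum_edge_sum[of x x] by (simp add: quad_form_def mult_ac)
qed

lemma rayleigh_perpE:
  assumes "r \<in> rayleigh_perp n (adj E)"
  obtains x where "(\<Sum>i<n. x i) = 0" "0 < dot n x x" "r = quad_form n (adj E) x / dot n x x"
proof -
  obtain x i where x: "r = quad_form n (adj E) x / (\<Sum>i<n. (x i)\<^sup>2)" "(\<Sum>i<n. x i) = 0" "i < n" "x i \<noteq> 0"
    using assms unfolding rayleigh_perp_def by blast
  then have "0 < (\<Sum>i<n. (x i)\<^sup>2)"
    by (intro sum_pos2[of _ i]) auto
  then show thesis
    using x by (intro that[of x]) (auto simp: dot_def power2_eq_square)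
qed

lemma rayleigh_perpI:
  assumes "(\<Sum>i<n. x i) = 0" "0 < dot n x x"
  shows "quad_form n (adj E) x / dot n x x \<in> rayleigh_perp n (adj E)"
proof -
  have "\<exists>i<n. x i \<noteq> 0"
  proof (rule ccontr)
    assume "\<not> ?thesis"
    then have "dot n x x = 0" by (simp add: dot_def)
    with assms(2) show False by simp
  qed
  then show ?thesis
    using assms(1) unfolding rayleigh_perp_def dot_def power2_eq_square by blast
qed

lemma laplacian_form_ge:
  assumes "(\<Sum>i<n. x i) = 0" "0 < dot n x x"
  shows "real d * (1 - lambda2 n E d) * dot n x x \<le> laplacian_form x"
proof -
  have "bdd_above (rayleigh_perp n (adj E))"
    unfolding bdd_above_def
    by (intro exI[of _ "real d"] ballI)
       (auto elim!: rayleigh_perpE simp: quad_form_adj laplacian_form_nonneg pos_divide_le_eq)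
  then have "quad_form n (adj E) x / dot n x x \<le> Sup (rayleigh_perp n (adj E))"
    by (intro cSup_upper rayleigh_perpI assms)
  also have "\<dots> = real d * lambda2 n E d"
    using d1 by (simp add: lambda2_def)
  finally have "quad_form n (adj E) x \<le> real d * lambda2 n E d * dot n x x"
    using assms by (simp add: pos_divide_le_eq)
  then show ?thesis
    by (simp add: quad_form_adj algebra_simps)
qed

lemma laplacian_form_le_perp:
  assumes "(\<Sum>i<n. x i) = 0" "0 < dot n x x"
  shows "laplacian_form x \<le> real d * (1 + abs_lambda_n n E d) * dot n x x"
proof -
  have "bdd_above (uminus ` rayleigh_perp n (adj E))"
    unfolding bdd_above_def
  proof (intro exI[of _ "real d"] ballI)
    fix y assume "y \<in> uminus ` rayleigh_perp n (adj E)"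
    then obtain x where x: "0 < dot n x x" "y = - quad_form n (adj E) x / dot n x x"
      by (auto elim: rayleigh_perpE)
    show "y \<le> real d"
      unfolding x(2) pos_divide_le_eq[OF x(1)] using quad_form_adj_ge[of x] by linarith
  qed
  then have "- (quad_form n (adj E) x / dot n x x) \<le> Sup (uminus ` rayleigh_perp n (adj E))"
    by (intro cSup_upper imageI rayleigh_perpI assms)
  also have "\<dots> = real d * abs_lambda_n n E d"
    using d1 by (simp add: abs_lambda_n_def)
  finally have "- quad_form n (adj E) x / dot n x x \<le> real d * abs_lambda_n n E d"
    by simp
  then have "- quad_form n (adj E) x \<le> real d * abs_lambda_n n E d * dot n x x"
    unfolding pos_divide_le_eq[OF assms(2)] .
  then show ?thesis
    by (simp add: quad_form_adj algebra_simps)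
qed

text \<open>Orthogonal projection off the constants. Edge differences do not see it, so spectral
  bounds on that complement transfer to arbitrary vectors.\<close>

definition center :: "(nat \<Rightarrow> real) \<Rightarrow> nat \<Rightarrow> real" where
  "center x = (\<lambda>i. x i - (\<Sum>i<n. x i) / real n)"

lemma sum_center: "(\<Sum>i<n. center x i) = 0"
  using n2 by (simp add: center_def sum_subtractf)

lemma dot_center_le: "dot n (center x) (center x) \<le> dot n x x"
proof -
  define c where "c = (\<Sum>i<n. x i) / real n"
  have center: "center x i = x i - c" for i
    by (simp add: center_def c_def)
  have "dot n x x = (\<Sum>i<n. center x i * center x i + 2 * c * center x i + c\<^sup>2)"
    unfolding dot_def by (intro sum.cong refl) (simp add: center power2_eq_square algebra_simps)
  also have "\<dots> = dot n (center x) (center x) + real n * c\<^sup>2"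
    by (simp add: sum.distrib sum_center dot_def flip: sum_distrib_left)
  finally show ?thesis by simp
qed

lemma dot_edge_diff_center:
  "e \<in> edge_set E \<Longrightarrow> dot n (edge_diff e) (center x) = dot n (edge_diff e) x"
  by (cases e) (auto simp: dot_edge_diff center_def dest!: edgeD)

lemma laplacian_form_center: "laplacian_form (center x) = laplacian_form x"
  by (simp add: laplacian_form_def dot_edge_diff_center)

lemma dot_self_pos: "i < n \<Longrightarrow> x i \<noteq> 0 \<Longrightarrow> 0 < dot n x x"
  unfolding dot_def by (rule sum_pos2[of _ i]) (auto simp: zero_less_mult_iff linorder_neq_iff)

text \<open>One test vector orthogonal to the constants, the difference of two unit vectors, meets
  both spectral bounds. Together with \<open>lambda2 n E d < 1\<close> this makes
  \<open>1 + abs_lambda_n n E d\<close> positive.\<close>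

lemma spectral_gap_le: "1 - lambda2 n E d \<le> 1 + abs_lambda_n n E d"
proof -
  let ?x = "edge_diff (0, 1)"
  have x: "(\<Sum>i<n. ?x i) = 0" "0 < dot n ?x ?x"
    using n2 dot_edge_diff[of 0 n 1 "\<lambda>_. 1"] dot_self_pos[of 0 ?x]
    by (auto simp: dot_def edge_diff_def unit_vec_def)
  have "real d * (1 - lambda2 n E d) * dot n ?x ?x \<le> real d * (1 + abs_lambda_n n E d) * dot n ?x ?x"
    using laplacian_form_ge[OF x] laplacian_form_le_perp[OF x] by linarith
  then show ?thesis
    using x(2) d1 by simp
qed

lemma laplacian_form_le:
  assumes "lambda2 n E d < 1"
  shows "laplacian_form x \<le> real d * (1 + abs_lambda_n n E d) * dot n x x"
proof -
  have \<kappa>: "0 \<le> real d * (1 + abs_lambda_n n E d)"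
    using assms spectral_gap_le by simp
  have "laplacian_form (center x) \<le> real d * (1 + abs_lambda_n n E d) * dot n (center x) (center x)"
  proof (cases "0 < dot n (center x) (center x)")
    case True
    then show ?thesis by (intro laplacian_form_le_perp sum_center)
  next
    case False
    then have "center x i = 0" if "i < n" for i
      using dot_self_pos that by blast
    then have "laplacian_form (center x) = 0"
      unfolding laplacian_form_def by (intro sum.neutral) (auto simp: dot_edge_diff dest!: edgeD)
    then show ?thesis
      using \<kappa> by (simp add: dot_self_nonneg)
  qed
  also have "\<dots> \<le> real d * (1 + abs_lambda_n n E d) * dot n x x"
    using \<kappa> by (intro mult_left_mono dot_center_le)
  finally show ?thesis by (simp add: laplacian_form_center)
qed

text \<open>Writing \<open>1 - 2 Z = (1 - 2 eps) - 2 (Z - eps)\<close> on each edge shows that the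
  certificate form is twice \<open>(1 - 2 eps)\<close> times the Laplacian form minus four times the
  centred noise. Centring \<open>v\<close> makes the spectral gap applicable to the first
  part.\<close>

lemma sdp_unique_opt_if_noise_small:
  fixes x :: "nat \<Rightarrow> bool"
  assumes eps: "eps < 1 / 2"
    and small: "\<And>v. 0 < dot n v v \<Longrightarrow>
      (\<Sum>e\<in>edge_set E. (of_bool (Z e) - eps) * (dot n (edge_diff e) v)\<^sup>2)
        < (1 - 2 * eps) * (real d * (1 - lambda2 n E d)) / 2 * dot n v v"
  shows "sdp_unique_opt n (Wmat E x Z) (\<lambda>i j. (if x i then -1 else 1) * (if x j then -1 else 1))"
proof (rule sdp_unique_opt_signs)
  let ?sign = "\<lambda>i j. if Z (min i j, max i j) then -1 else (1 :: real)"
  show "Wmat E x Z i j = (if x i then -1 else 1) * (if x j then -1 else 1) * (adj E i j * ?sign i j)" for i j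
    by (auto simp: Wmat_def obs_def adj_def)
  fix v :: "nat \<Rightarrow> real" and i j
  assume ij: "i < n" "j < n" "v i \<noteq> v j"
  have "center v i \<noteq> 0 \<or> center v j \<noteq> 0"
    using ij(3) by (auto simp: center_def)
  then have pos: "0 < dot n (center v) (center v)"
    using dot_self_pos ij by blast
  have "2 * (\<Sum>e\<in>edge_set E. (of_bool (Z e) - eps) * (dot n (edge_diff e) v)\<^sup>2)
      = 2 * (\<Sum>e\<in>edge_set E. (of_bool (Z e) - eps) * (dot n (edge_diff e) (center v))\<^sup>2)"
    by (simp add: dot_edge_diff_center)
  also have "\<dots> < (1 - 2 * eps) * (real d * (1 - lambda2 n E d) * dot n (center v) (center v))"
    using small[OF pos] by simp
  also have "\<dots> \<le> (1 - 2 * eps) * laplacian_form (center v)"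
    using eps pos by (intro mult_left_mono laplacian_form_ge sum_center) auto
  also have "\<dots> = (1 - 2 * eps) * laplacian_form v"
    by (simp add: laplacian_form_center)
  finally have "0 < 2 * ((1 - 2 * eps) * laplacian_form v
      - 2 * (\<Sum>e\<in>edge_set E. (of_bool (Z e) - eps) * (dot n (edge_diff e) v)\<^sup>2))"
    by (simp add: mult.commute[of "laplacian_form v"])
  also have "\<dots> = (\<Sum>e\<in>edge_set E. 2 * ((1 - 2 * of_bool (Z e)) * (dot n (edge_diff e) v)\<^sup>2))"
    unfolding laplacian_form_def sum_distrib_left sum_subtractf[symmetric]
    by (intro sum.cong refl) (simp add: algebra_simps)
  also have "\<dots> = (\<Sum>(i, j)\<in>edge_set E. ?sign i j * (v i - v j)\<^sup>2 + ?sign j i * (v j - v i)\<^sup>2)"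
  proof (intro sum.cong refl, clarify)
    fix a b assume "(a, b) \<in> edge_set E"
    then have "a < n" "b < n" "a < b" using edgeD by auto
    then show "2 * ((1 - 2 * of_bool (Z (a, b))) * (dot n (edge_diff (a, b)) v)\<^sup>2)
        = ?sign a b * (v a - v b)\<^sup>2 + ?sign b a * (v b - v a)\<^sup>2"
      by (simp add: dot_edge_diff min_def max_def power2_commute[of "v b" "v a"])
  qed
  also have "\<dots> = (\<Sum>i<n. \<Sum>j<n. adj E i j * (?sign i j * (v i - v j)\<^sup>2))"
    by (rule sum_adj_eq_sum_edges[symmetric])
  finally show "0 < (\<Sum>i<n. \<Sum>j<n. adj E i j * ?sign i j * (v i - v j)\<^sup>2)"
    by (simp only: mult.assoc)
qed simp

end

section \<open>From the degree condition to the failure probability\<close>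

lemma bernstein_exponent:
  fixes d L \<beta> \<gamma> eps delta :: real
  assumes pos: "0 < d" "0 < L" "0 < \<beta>" "0 < \<gamma>" "0 < eps" "eps < 1 / 2"
    and cond: "d / L \<ge> 4 * \<gamma> / \<beta>\<^sup>2 * (1 + delta) *
      (1 / (1 - 2 * eps)\<^sup>2 + 1 / 3 * \<beta> / ((1 - 2 * eps) * \<gamma>) + 1 / 3 * \<beta> / \<gamma> - 1)"
  defines "t \<equiv> (1 - 2 * eps) * (d * \<beta>) / 2"
  shows "(1 + delta) * L \<le> (t\<^sup>2 / 2) / (2 * (d * \<gamma>) * eps * (1 - eps) + 2 * (1 - eps) * t / 3)"
proof -
  \<comment> \<open>Since \<open>4 * eps * (1 - eps) = 1 - \<mu>\<^sup>2\<close>, the Bernstein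
    denominator becomes \<open>d * K / 2\<close>, while the bracket of the hypothesis times
    \<open>\<gamma>\<close> equals \<open>K / \<mu>\<^sup>2\<close>.\<close>
  define \<mu> where "\<mu> = 1 - 2 * eps"
  define K where "K = \<gamma> * (1 - \<mu>\<^sup>2) + \<beta> * \<mu> / 3 + \<beta> * \<mu>\<^sup>2 / 3"
  have \<mu>: "0 < \<mu>" "\<mu> < 1" using pos by (simp_all add: \<mu>_def)
  then have "\<mu>\<^sup>2 < 1" by (simp add: power_less_one_iff abs_square_less_1)
  then have K: "0 < K"
    unfolding K_def using pos \<mu> by (intro add_pos_pos) simp_all
  have denom: "2 * (d * \<gamma>) * eps * (1 - eps) + 2 * (1 - eps) * t / 3 = d * K / 2"
  proof -
    have eps_eq: "eps = (1 - \<mu>) / 2" by (simp add: \<mu>_def)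
    show ?thesis
      unfolding t_def K_def \<mu>_def[symmetric] unfolding eps_eq
      by (simp add: power2_eq_square field_simps)
  qed
  have "4 * \<gamma> / \<beta>\<^sup>2 * (1 + delta) * (1 / \<mu>\<^sup>2 + 1 / 3 * \<beta> / (\<mu> * \<gamma>) + 1 / 3 * \<beta> / \<gamma> - 1)
      = 4 * (1 + delta) * K / (\<beta>\<^sup>2 * \<mu>\<^sup>2)"
  proof -
    have bracket: "\<gamma> * (1 / \<mu>\<^sup>2 + 1 / 3 * \<beta> / (\<mu> * \<gamma>) + 1 / 3 * \<beta> / \<gamma> - 1) = K / \<mu>\<^sup>2"
      unfolding K_def using pos \<mu> by (simp add: field_simps power2_eq_square)
    have assoc: "4 * \<gamma> / \<beta>\<^sup>2 * (1 + delta) * R = 4 * (1 + delta) * (\<gamma> * R) / \<beta>\<^sup>2" for R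
      by simp
    show ?thesis
      unfolding assoc bracket by (simp add: mult.commute)
  qed
  with cond have "4 * (1 + delta) * K / (\<beta>\<^sup>2 * \<mu>\<^sup>2) \<le> d / L"
    by (simp add: \<mu>_def)
  then have "4 * (1 + delta) * K * L \<le> d * (\<beta>\<^sup>2 * \<mu>\<^sup>2)"
    using pos \<mu> by (simp add: divide_le_eq pos_le_divide_eq mult_ac)
  then have "d * (4 * (1 + delta) * K * L) \<le> d * (d * (\<beta>\<^sup>2 * \<mu>\<^sup>2))"
    using pos by (intro mult_left_mono) auto
  moreover have "t\<^sup>2 / 2 = d * (d * (\<beta>\<^sup>2 * \<mu>\<^sup>2)) / 8"
    unfolding t_def \<mu>_def[symmetric] by (simp add: power2_eq_square)
  ultimately have "(1 + delta) * L * (d * K / 2) \<le> t\<^sup>2 / 2"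
    by (simp add: algebra_simps)
  then show ?thesis
    unfolding denom using pos K by (subst pos_le_divide_eq) auto
qed

theorem theorem5:
  fixes n d :: nat and E :: "nat \<Rightarrow> nat \<Rightarrow> bool" and x :: "nat \<Rightarrow> bool"
    and eps delta :: real
  assumes n2: "n \<ge> 2" and d1: "d \<ge> 1"
    and G: "simple_graph n E" and reg: "regular n E d"
    and l2: "lambda2 n E d < 1"
    and eps: "0 < eps" "eps < 1/2"
    and delta: "delta > 0"
    and cond: "real d / ln (real n) \<ge>
       4 * (1 + abs_lambda_n n E d) / (1 - lambda2 n E d)\<^sup>2 * (1 + delta) *
       (1 / (1 - 2*eps)\<^sup>2
        + 1/3 * (1 - lambda2 n E d) / ((1 - 2*eps) * (1 + abs_lambda_n n E d))
        + 1/3 * (1 - lambda2 n E d) / (1 + abs_lambda_n n E d) - 1)"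
  shows "measure_pmf.prob (noise_pmf E eps)
           {Z. sdp_unique_opt n (Wmat E x Z)
                 (\<lambda>i j. (if x i then -1 else 1) * (if x j then -1 else 1))}
         \<ge> 1 - real n powr (- delta)"
proof -
  interpret regular_graph n d E
    by unfold_locales (fact n2 d1 G reg)+
  define \<kappa> where "\<kappa> = real d * (1 + abs_lambda_n n E d)"
  define t where "t = (1 - 2 * eps) * (real d * (1 - lambda2 n E d)) / 2"
  have \<gamma>: "0 < 1 + abs_lambda_n n E d"
    using l2 spectral_gap_le by linarith
  have \<kappa>: "0 < \<kappa>"
    using d1 \<gamma> by (simp add: \<kappa>_def)
  have t: "0 \<le> t"
    unfolding t_def using eps l2 by simp
  interpret noisy: bernoulli_frame n "edge_set E" edge_diff edge_sum "2 * real d" eps \<kappa>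
  proof
    fix e assume "e \<in> edge_set E"
    then show "dot n (edge_diff e) (edge_diff e) = 2"
      by (cases e) (auto simp: dot_edge_diff dest!: edgeD, simp add: edge_diff_def unit_vec_def)
  qed (use finite_edge_set eps \<kappa> laplacian_form_le[OF l2] in
        \<open>auto simp: sum_edge_diff sum_edge_sum laplacian_form_def \<kappa>_def\<close>)
  let ?bad = "{Z. \<exists>v. 0 < dot n v v \<and>
    t * dot n v v \<le> (\<Sum>e\<in>edge_set E. (of_bool (Z e) - eps) * (dot n (edge_diff e) v)\<^sup>2)}"
  let ?good = "{Z. sdp_unique_opt n (Wmat E x Z)
    (\<lambda>i j. (if x i then -1 else 1) * (if x j then -1 else 1))}"
  have "Z \<in> ?good" if "Z \<notin> ?bad" for Z
    using that sdp_unique_opt_if_noise_small[OF eps(2), of Z x]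
    by (auto simp: t_def not_le)
  then have "- ?bad \<subseteq> ?good" by blast
  then have "measure_pmf.prob noisy.noise (- ?bad) \<le> measure_pmf.prob noisy.noise ?good"
    by (intro measure_pmf.finite_measure_mono) auto
  then have "1 - measure_pmf.prob noisy.noise ?bad \<le> measure_pmf.prob noisy.noise ?good"
    by (simp add: measure_pmf.prob_compl[of ?bad noisy.noise, simplified] Compl_eq_Diff_UNIV)
  moreover have "measure_pmf.prob noisy.noise ?bad \<le> real n powr (- delta)"
  proof -
    have ln: "0 < ln (real n)" using n2 by simp
    have "measure_pmf.prob noisy.noise ?bad
        \<le> real n * exp (- (t\<^sup>2 / 2) / (2 * \<kappa> * eps * (1 - eps) + 2 * (1 - eps) * t / 3))"
      by (rule noisy.bernstein_rank_one[OF \<kappa> t])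
    \<comment> \<open>The dimensional factor \<open>n\<close> from the trace is paid for by the 1 in
      \<open>1 + delta\<close>.\<close>
    also have "\<dots> \<le> real n * exp (- ((1 + delta) * ln (real n)))"
      using bernstein_exponent[OF _ ln _ \<gamma> eps cond] d1 l2
      unfolding t_def[symmetric] \<kappa>_def[symmetric] by (intro mult_left_mono) simp_all
    also have "\<dots> = real n powr (- delta)"
      using n2 by (simp add: powr_def algebra_simps exp_diff exp_minus field_simps exp_add)
    finally show ?thesis .
  qed
  ultimately show ?thesis
    unfolding noise_pmf_def by linarith
qed

end
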